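(* Let $\Phi:\mathbb{C}\to\mathbb{C}$ be an entire function of exponential type. Suppose there exist complex scalars $z_0,z_1$ with $z_0\in(0,z_1)$ such that (i) $|\Phi|<1$ on $(0,z_0]$, and (ii) $|\Phi(z_1)|>\max\{1,e^{\tau_0|z_1|}\}$, where $$\tau_0=\tau_0(z_1)=\limsup_{r\to\infty}\frac{\log\left|\Phi\left(r\frac{z_1}{|z_1|}\right)\right|}{r}.$$ Then $\Phi(D)$ supports a hypercyclic algebra.
   Context: For $z,w\in\mathbb{C}$, $(z,w)$ and $(z,w]$ denote line segments in the complex plane: $(0,z_1)=\{tz_1:0<t<1\}$ and $(0,z_0]=\{tz_0:0<t\le1\}$ (in particular $z_1\ne0$). $H(\mathbb{C})$ is the algebra (under pointwise multiplication) of entire functions on $\mathbb{C}$ with the compact-open topology, and $D:f\mapsto f'$. An entire function $\Phi$ is of exponential type if there are constants $A,B<\infty$ with $|\Phi(z)|\le Ae^{B|z|}$ for all $z$. For such $\Phi(z)=\sum_{n\ge0}a_nz^n$, $\Phi(D):H(\mathbb{C})\to H(\mathbb{C})$ is the continuous linear operator $f\mapsto\sum_{n\ge0}a_nD^nf$. A vector is hypercyclic for an operator $T$ if its orbit under $T$ is dense. A hypercyclic algebra for $T$ is a (nonzero) subalgebra all of whose non-zero elements are hypercyclic vectors for $T$; "$T$ supports a hypercyclic algebra" means that one exists. *)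

theory Defs
  imports "HOL-Analysis.Analysis"
begin

definition entire_functions :: "(complex \<Rightarrow> complex) set" where
  "entire_functions = {f. f holomorphic_on UNIV}"

definition entire_topology :: "(complex \<Rightarrow> complex) topology" where
  "entire_topology = topology_generated_by
     {{f \<in> entire_functions. f ` K \<subseteq> U} | K U. compact K \<and> open U}"

lemma topspace_entire_topology: "topspace entire_topology = entire_functions"
proof -
  have "entire_functions \<in> {{f \<in> entire_functions. f ` K \<subseteq> U} | K U. compact K \<and> open U}"
    by (rule CollectI, intro exI[of _ "{}"]) auto
  then show ?thesis
    unfolding entire_topology_def topology_generated_by_topspace by auto
qed

definition exponential_type :: "(complex \<Rightarrow> complex) \<Rightarrow> bool" where
  "exponential_type \<Phi> \<longleftrightarrow> (\<exists>A B::real. \<forall>z. norm (\<Phi> z) \<le> A * exp (B * norm z))"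

(* The coefficients of the series are the Taylor coefficients of \<Phi> at 0.  For entire \<Phi> of
   exponential type and entire f the series converges uniformly on compact sets, so the
   pointwise sum is its sum in the compact-open topology. *)
definition diff_operator :: "(complex \<Rightarrow> complex) \<Rightarrow> (complex \<Rightarrow> complex) \<Rightarrow> complex \<Rightarrow> complex" where
  "diff_operator \<Phi> f = (\<lambda>z. \<Sum>n. (deriv ^^ n) \<Phi> 0 / fact n * (deriv ^^ n) f z)"

definition hypercyclic_vector :: "'a topology \<Rightarrow> ('a \<Rightarrow> 'a) \<Rightarrow> 'a \<Rightarrow> bool" where
  "hypercyclic_vector X T x \<longleftrightarrow>
     x \<in> topspace X \<and> X closure_of (range (\<lambda>n::nat. (T ^^ n) x)) = topspace X"

(* Not required to contain the constant function 1. *)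
definition entire_subalgebra :: "(complex \<Rightarrow> complex) set \<Rightarrow> bool" where
  "entire_subalgebra A \<longleftrightarrow>
     A \<subseteq> entire_functions \<and> (\<lambda>z. 0) \<in> A \<and>
     (\<forall>f\<in>A. \<forall>g\<in>A. (\<lambda>z. f z + g z) \<in> A) \<and>
     (\<forall>c. \<forall>f\<in>A. (\<lambda>z. c * f z) \<in> A) \<and>
     (\<forall>f\<in>A. \<forall>g\<in>A. (\<lambda>z. f z * g z) \<in> A)"

definition supports_hypercyclic_algebra ::
    "((complex \<Rightarrow> complex) \<Rightarrow> (complex \<Rightarrow> complex)) \<Rightarrow> bool" where
  "supports_hypercyclic_algebra T \<longleftrightarrow>
     (\<exists>A. entire_subalgebra A \<and> A \<noteq> {\<lambda>z. 0} \<and>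
          (\<forall>f\<in>A. f \<noteq> (\<lambda>z. 0) \<longrightarrow> hypercyclic_vector entire_topology T f))"

(* ln 0 = 0 in HOL, whereas log |\<Phi>| is -\<infinity> at the zeros of \<Phi>. *)
definition log_modulus :: "complex \<Rightarrow> ereal" where
  "log_modulus w = (if w = 0 then -\<infinity> else ereal (ln (norm w)))"

definition radial_growth :: "(complex \<Rightarrow> complex) \<Rightarrow> complex \<Rightarrow> ereal" where
  "radial_growth \<Phi> w =
     Limsup at_top (\<lambda>r::real. log_modulus (\<Phi> (of_real r * (w / of_real (norm w)))) / ereal r)"

definition exp_ereal :: "ereal \<Rightarrow> ereal" where
  "exp_ereal x = (case x of ereal r \<Rightarrow> ereal (exp r) | PInfty \<Rightarrow> \<infinity> | MInfty \<Rightarrow> 0)"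

end

theory Submission
  imports Defs "HOL-Complex_Analysis.Complex_Analysis"
begin

text \<open>
  Write $T = \Phi(D)$. Exponentials are eigenvectors, $T e^{cz} = \Phi(c) e^{cz}$, so the orbit of a
  finite exponential sum is explicit. A Baire category argument reduces the theorem to the following
  transitivity property of powers: for all entire $g$, $h$ and all $m \ge 1$ there are an entire $f$
  near $g$ and an $N$ such that $T^N f^m$ is near $h$ while $T^N f^j$ is near $0$ for $1 \le j < m$.
  A generic $f$ then has this property for all $h$ and $m$ at once, and the polynomials $p(f)$ with
  $p(0) = 0$ form a hypercyclic algebra, because in $T^N p(f)$ only the leading term of $p$ survives
  (\<open>supports_hypercyclic_algebra_if_powers_transitive\<close>).

  For the transitivity property take
  $f = \sum_{\gamma\in\Gamma} a_\gamma e^{\gamma z} + \sum_{b\in B} \rho_b \sigma_b^N e^{bz}$,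
  where the first sum approximates $g$ with frequencies on the segment $(0, z_0/m)$, where
  $\sigma_b^m \Phi(mb) = 1$, and where $\sum_{b\in B} \rho_b^m e^{mbz}$ approximates $h$. When $f^j$ is expanded, a
  word $p$ of $j$ frequencies contributes to $T^N f^j$ a multiple of
  $\bigl(\prod_i \sigma_{p(i)} \cdot \Phi(\sum_i p(i))\bigr)^N e^{(\sum_i p(i)) z}$, with $\sigma_\gamma = 1$
  on $\Gamma$. For a constant word of length $m$ over $B$ the number under the power is $1$, and these words add up
  to the target (\<open>constant_words_dominate\<close>). Every other word has to be contracted, and there
  are three kinds (\<open>mixed_words_contract\<close>).

  Words over $\Gamma$: their sum lies on $(0, z_0]$, where $|\Phi| < 1$.

  Words with $k$ letters in $B$, $1 \le k < m$: if all $mb$ are near a point $w$ and the elements of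
  $\Gamma$ are small, it suffices that $|\Phi(kw/m)|^m < |\Phi(w)|^k$. Let $u = z_1/|z_1|$. The quotient
  $\log|\Phi(ru)|/r$ is negative for small $r > 0$, and at $r = |z_1|$ it is positive and larger than
  its upper limit at infinity; so it has a positive maximum. Let $w = Ru$ with $R$ the least point
  where the maximum is attained; leastness makes the inequalities strict
  (\<open>subordinate_growth\<close>).

  Nonconstant words of length $m$ over $B$: here the points $mb$ have to lie on a segment along which
  $\log|\Phi|$ is strictly convex. Near $w$ write $\Phi = e^g$, so that $\log|\Phi| = \mathrm{Re}\, g$. At a
  point where $g'' \ne 0$, a direction $d$ with $g'' d^2 > 0$ is a direction of strict convexity
  (\<open>log_norm_strictly_convex_direction\<close>); the ray through $w$ itself need not be one, since
  $\log|\Phi(ru)| - Mr$, with $M$ the maximum above, has a maximum at $R$. If $g''$ vanished identically, then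
  $\Phi(z) = e^{\alpha+\beta z}$, and the quotient $\mathrm{Re}\,\alpha/r + \mathrm{Re}(\beta u)$, being
  strictly monotone or constant in $r$, would not have a least maximum point.

  All the strict inequalities survive small perturbations of $w$, so the segment can be placed near $w$.
  Finally, the exponentials with frequencies on any nondegenerate segment span a dense
  subspace (\<open>exponential_sums_dense\<close>), which provides both approximations.
\<close>

section \<open>The compact-open topology on entire functions\<close>

lemma entire_functions_holomorphic:
  "f \<in> entire_functions \<longleftrightarrow> f holomorphic_on UNIV"
  by (simp add: entire_functions_def)

lemma entire_functions_continuous:
  "f \<in> entire_functions \<Longrightarrow> continuous_on S f"
  unfolding entire_functions_holomorphic
  by (rule continuous_on_subset[OF holomorphic_on_imp_continuous_on subset_UNIV])

lemma entire_functions_sum: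
  assumes "\<And>i. i \<in> I \<Longrightarrow> f i \<in> entire_functions"
  shows "(\<lambda>z. \<Sum>i\<in>I. c i * f i z) \<in> entire_functions"
  using assms unfolding entire_functions_def by (auto intro!: holomorphic_intros)

lemma entire_functions_bounded:
  assumes "f \<in> entire_functions"
  obtains M where "0 < M" "\<And>z. z \<in> cball 0 R \<Longrightarrow> norm (f z) \<le> M"
proof -
  have "bounded (f ` cball 0 R)"
    using assms by (intro compact_imp_bounded compact_continuous_image)
      (auto intro: entire_functions_continuous)
  then obtain M where "0 < M" "\<forall>x\<in>f ` cball 0 R. norm x \<le> M"
    unfolding bounded_pos by blast
  then show ?thesis by (intro that[of M]) auto
qed

definition entire_ball :: "(complex \<Rightarrow> complex) \<Rightarrow> real \<Rightarrow> real \<Rightarrow> (complex \<Rightarrow> complex) set" where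
  "entire_ball f R \<delta> = {g \<in> entire_functions. \<forall>z\<in>cball 0 R. norm (g z - f z) \<le> \<delta>}"

lemma entire_ball_mono:
  "R' \<le> R \<Longrightarrow> \<delta> \<le> \<delta>' \<Longrightarrow> entire_ball f R \<delta> \<subseteq> entire_ball f R' \<delta>'"
  unfolding entire_ball_def
proof clarify
  fix g :: "complex \<Rightarrow> complex" and z :: complex
  assume "R' \<le> R" "\<delta> \<le> \<delta>'" "\<forall>z\<in>cball 0 R. norm (g z - f z) \<le> \<delta>" "z \<in> cball 0 R'"
  moreover from this have "z \<in> cball 0 R" by simp
  ultimately show "norm (g z - f z) \<le> \<delta>'" by fastforce
qed

lemma entire_ball_triangle:
  assumes "g \<in> entire_ball f R \<delta>" "R \<le> R'" "\<delta>' + \<delta> \<le> \<delta>''"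
  shows "entire_ball g R' \<delta>' \<subseteq> entire_ball f R \<delta>''"
proof
  fix h assume h: "h \<in> entire_ball g R' \<delta>'"
  have "norm (h z - f z) \<le> \<delta>''" if "z \<in> cball 0 R" for z
  proof -
    have "norm (h z - f z) \<le> norm (h z - g z) + norm (g z - f z)"
      using norm_triangle_ineq[of "h z - g z" "g z - f z"] by simp
    moreover have "norm (h z - g z) \<le> \<delta>'" "norm (g z - f z) \<le> \<delta>"
      using h assms that by (auto simp: entire_ball_def)
    ultimately show ?thesis using assms(3) by linarith
  qed
  then show "h \<in> entire_ball f R \<delta>''" using h by (simp add: entire_ball_def)
qed

text \<open>
  Subbasic open sets are given by a compact set mapped into an open set, and the image of that compact
  set has positive distance to the complement of the open set.
\<close>
lemma openin_entire_topology_contains_ball: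
  assumes "openin entire_topology U" "f \<in> U"
  shows "\<exists>R \<delta>. 0 < \<delta> \<and> entire_ball f R \<delta> \<subseteq> U"
proof -
  let ?S = "{{f \<in> entire_functions. f ` K \<subseteq> U} | K U. compact K \<and> open U}"
  have "generate_topology_on ?S U"
    using assms(1) unfolding entire_topology_def by (rule openin_topology_generated_by)
  then show ?thesis using assms(2)
  proof (induction arbitrary: f rule: generate_topology_on.induct)
    case Empty
    then show ?case by simp
  next
    case (Int a b)
    then obtain R \<delta> R' \<delta>' where "0 < \<delta>" "entire_ball f R \<delta> \<subseteq> a" "0 < \<delta>'" "entire_ball f R' \<delta>' \<subseteq> b"
      by (meson IntE)
    moreover have "entire_ball f (max R R') (min \<delta> \<delta>') \<subseteq> entire_ball f R \<delta> \<inter> entire_ball f R' \<delta>'"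
      by (intro Int_greatest entire_ball_mono) auto
    ultimately show ?case
      by (intro exI[of _ "max R R'"] exI[of _ "min \<delta> \<delta>'"]) auto
  next
    case (UN K)
    then obtain k where k: "k \<in> K" "f \<in> k" by blast
    then obtain R \<delta> where "0 < \<delta>" "entire_ball f R \<delta> \<subseteq> k" using UN.IH by blast
    then show ?case using k by blast
  next
    case (Basis s)
    then obtain K V where KV: "s = {f \<in> entire_functions. f ` K \<subseteq> V}" "compact K" "open V"
      by blast
    have comp: "compact (f ` K)"
      using KV Basis by (intro compact_continuous_image) (auto intro: entire_functions_continuous)
    have sub: "f ` K \<subseteq> V" using KV Basis by blast
    obtain \<epsilon> where \<epsilon>: "\<epsilon> > 0" "(\<Union>x\<in>f ` K. cball x \<epsilon>) \<subseteq> V"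
      using compact_subset_open_imp_cball_epsilon_subset[OF comp KV(3) sub] .
    obtain R where R: "K \<subseteq> cball 0 R"
      using compact_imp_bounded[OF KV(2)] by (auto simp: bounded_iff subset_iff)
    have "entire_ball f R \<epsilon> \<subseteq> s"
    proof
      fix g assume g: "g \<in> entire_ball f R \<epsilon>"
      have "g x \<in> V" if "x \<in> K" for x
      proof -
        have "g x \<in> cball (f x) \<epsilon>"
          using g R that by (auto simp: entire_ball_def dist_norm norm_minus_commute)
        then show ?thesis using \<epsilon> that by blast
      qed
      then show "g \<in> s" using g KV by (auto simp: entire_ball_def)
    qed
    then show ?case using \<epsilon>(1) by blast
  qed
qed

lemma hypercyclic_vectorI:
  assumes "f \<in> entire_functions" "\<And>g. g \<in> entire_functions \<Longrightarrow> T g \<in> entire_functions"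
    and "\<And>g R \<epsilon>. g \<in> entire_functions \<Longrightarrow> 0 < \<epsilon> \<Longrightarrow>
           \<exists>N. \<forall>z\<in>cball 0 R. norm ((T ^^ N) f z - g z) \<le> \<epsilon>"
  shows "hypercyclic_vector entire_topology T f"
proof -
  have iter: "(T ^^ N) f \<in> entire_functions" for N
    using assms(1,2) by (induction N) auto
  have "g \<in> entire_topology closure_of (range (\<lambda>n. (T ^^ n) f))" if g: "g \<in> entire_functions" for g
    unfolding in_closure_of
  proof (intro conjI allI impI)
    show "g \<in> topspace entire_topology" using g by (simp add: topspace_entire_topology)
    fix U assume U: "g \<in> U \<and> openin entire_topology U"
    then obtain R \<delta> where R: "0 < \<delta>" "entire_ball g R \<delta> \<subseteq> U"
      using openin_entire_topology_contains_ball by blast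
    then obtain N where "\<forall>z\<in>cball 0 R. norm ((T ^^ N) f z - g z) \<le> \<delta>"
      using assms(3) g by blast
    then have "(T ^^ N) f \<in> U" using R iter by (auto simp: entire_ball_def)
    then show "\<exists>y. y \<in> range (\<lambda>n. (T ^^ n) f) \<and> y \<in> U" by blast
  qed
  then have "entire_topology closure_of (range (\<lambda>n. (T ^^ n) f)) = topspace entire_topology"
    by (intro equalityI closure_of_subset_topspace) (auto simp: topspace_entire_topology)
  then show ?thesis
    using assms(1) by (simp add: hypercyclic_vector_def topspace_entire_topology)
qed

text \<open>
  The centres of the balls form a Cauchy sequence uniformly on every compact set, because the radii of the
  discs exhaust the plane; the limit is entire by the theorem of Weierstrass.
\<close>
lemma entire_ball_limit:
  fixes f :: "nat \<Rightarrow> complex \<Rightarrow> complex" and \<delta> R :: "nat \<Rightarrow> real"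
  assumes mem: "\<And>m n. n \<le> m \<Longrightarrow> f m \<in> entire_ball (f n) (R n) (\<delta> n)"
    and \<delta>: "\<delta> \<longlonglongrightarrow> 0" and R: "\<And>n. real n \<le> R n"
  obtains F where "F \<in> entire_functions" "\<And>n. F \<in> entire_ball (f n) (R n) (\<delta> n)"
proof -
  have entire: "f n \<in> entire_functions" for n
    using mem[of n n] by (simp add: entire_ball_def)
  have close: "norm (f m z - f n z) \<le> \<delta> n" if "n \<le> m" "norm z \<le> R n" for m n z
    using mem[OF that(1)] that(2) by (auto simp: entire_ball_def)
  have "Cauchy (\<lambda>n. f n z)" for z
  proof (rule metric_CauchyI)
    fix e :: real assume "e > 0"
    then have "eventually (\<lambda>n. \<delta> n < e / 2) sequentially"
      using order_tendstoD(2)[OF \<delta>, of "e/2"] by simp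
    moreover have "eventually (\<lambda>n. norm z \<le> real n) sequentially"
      by real_asymp
    ultimately have "eventually (\<lambda>n. \<delta> n < e / 2 \<and> norm z \<le> real n) sequentially"
      by (rule eventually_conj)
    then obtain n where n: "\<delta> n < e / 2" "norm z \<le> real n"
      using eventually_happens'[OF sequentially_bot] by blast
    have "dist (f m z) (f k z) < e" if "m \<ge> n" "k \<ge> n" for m k
    proof -
      have "norm (f m z - f n z) \<le> \<delta> n" "norm (f k z - f n z) \<le> \<delta> n"
        using close that n R[of n] by auto
      then show ?thesis using n norm_triangle_ineq4[of "f m z - f n z" "f k z - f n z"]
        by (simp add: dist_norm)
    qed
    then show "\<exists>M. \<forall>m\<ge>M. \<forall>n\<ge>M. dist (f m z) (f n z) < e" by blast
  qed
  then have F: "(\<lambda>n. f n z) \<longlonglongrightarrow> lim (\<lambda>n. f n z)" for z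
    by (simp add: Cauchy_convergent_iff convergent_LIMSEQ_iff)
  define F where "F z = lim (\<lambda>n. f n z)" for z
  note F = F[folded F_def]
  have lim: "norm (F z - f n z) \<le> \<delta> n" if "norm z \<le> R n" for n z
  proof (rule LIMSEQ_le_const2)
    show "(\<lambda>m. norm (f m z - f n z)) \<longlonglongrightarrow> norm (F z - f n z)"
      by (intro tendsto_intros F)
    show "\<exists>N. \<forall>m\<ge>N. norm (f m z - f n z) \<le> \<delta> n" using close that by blast
  qed
  have "F holomorphic_on UNIV"
  proof (rule holomorphic_uniform_sequence[OF open_UNIV])
    show "f n holomorphic_on UNIV" for n using entire by (simp add: entire_functions_holomorphic)
    fix x :: complex
    have "uniform_limit (cball x 1) f F sequentially"
    proof (rule uniform_limitI)
      fix e :: real assume "e > 0"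
      then have "eventually (\<lambda>n. \<delta> n < e) sequentially"
        using order_tendstoD(2)[OF \<delta>] by simp
      moreover have "eventually (\<lambda>n. norm x + 1 \<le> real n) sequentially" by real_asymp
      ultimately show "eventually (\<lambda>n. \<forall>y\<in>cball x 1. dist (f n y) (F y) < e) sequentially"
      proof eventually_elim
        case (elim n)
        show ?case
        proof
          fix y assume y: "y \<in> cball x 1"
          then have "norm y \<le> norm x + 1"
            using norm_triangle_ineq2[of y x] by (simp add: dist_norm norm_minus_commute)
          then have "norm y \<le> R n" using elim R[of n] by linarith
          then show "dist (f n y) (F y) < e"
            using lim[of y n] elim by (simp add: dist_norm norm_minus_commute)
        qed
      qed
    qed
    then show "\<exists>d>0. cball x d \<subseteq> UNIV \<and> uniform_limit (cball x d) f F sequentially"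
      by (intro exI[of _ 1]) auto
  qed
  then show ?thesis using lim that by (auto simp: entire_ball_def entire_functions_holomorphic)
qed

text \<open>
  The Baire category theorem for entire functions. It is enough to say that every ball contains the
  centre of a ball inside the given set: this is density of the interior.
\<close>
lemma entire_Baire:
  assumes "countable \<G>"
    and dense: "\<And>G f R \<delta>. G \<in> \<G> \<Longrightarrow> f \<in> entire_functions \<Longrightarrow> 0 < \<delta> \<Longrightarrow>
      \<exists>g\<in>entire_ball f R \<delta>. \<exists>R' \<delta>'. 0 < \<delta>' \<and> entire_ball g R' \<delta>' \<subseteq> G"
  shows "\<exists>f\<in>entire_functions. \<forall>G\<in>\<G>. f \<in> G"
proof (cases "\<G> = {}")
  case True
  have "(\<lambda>z. 0) \<in> entire_functions" by (simp add: entire_functions_def)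
  then show ?thesis using True by blast
next
  case False
  define G where "G = from_nat_into \<G>"
  have G: "G n \<in> \<G>" for n using False by (simp add: G_def from_nat_into)
  define P where "P n x \<longleftrightarrow> (case x of (f, R, \<delta>) \<Rightarrow> f \<in> entire_functions \<and> real n \<le> R \<and>
      0 < \<delta> \<and> \<delta> \<le> 1 / (real n + 1))" for n and x :: "(complex \<Rightarrow> complex) \<times> real \<times> real"
  define B where "B x = (case x of (f, R, \<delta>) \<Rightarrow> entire_ball f R \<delta>)"
    for x :: "(complex \<Rightarrow> complex) \<times> real \<times> real"
  have start: "P 0 ((\<lambda>z. 0), 0, 1)"
    by (simp add: P_def entire_functions_def)
  have step: "\<exists>y. P (Suc n) y \<and> B y \<subseteq> B x \<inter> G n" if "P n x" for n x
  proof -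
    obtain f R \<delta> where x: "x = (f, R, \<delta>)" by (cases x)
    have f: "f \<in> entire_functions" "0 < \<delta>/2" using that by (auto simp: P_def x)
    obtain g R' \<delta>' where g: "g \<in> entire_ball f R (\<delta>/2)" "0 < \<delta>'" "entire_ball g R' \<delta>' \<subseteq> G n"
      using dense[OF G f, of R n] by blast
    define y where "y = (g, max R' (max R (real (Suc n))), min \<delta>' (min (\<delta>/2) (1 / (real (Suc n) + 1))))"
    have "P (Suc n) y" using g f by (auto simp: P_def y_def entire_ball_def)
    moreover have "B y \<subseteq> entire_ball g R' \<delta>'" unfolding B_def y_def prod.case
      by (rule entire_ball_mono) auto
    moreover have "B y \<subseteq> B x" unfolding B_def y_def x prod.case
      by (rule entire_ball_triangle[OF g(1)]) (auto simp: min_def)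
    ultimately show ?thesis using g(3) by blast
  qed
  obtain s where s: "\<And>n. P n (s n)" "\<And>n. B (s (Suc n)) \<subseteq> B (s n) \<inter> G n"
    using dependent_nat_choice[of P "\<lambda>n x y. B y \<subseteq> B x \<inter> G n"] start step by metis
  define f where "f n = fst (s n)" for n
  define R where "R n = fst (snd (s n))" for n
  define \<delta> where "\<delta> n = snd (snd (s n))" for n
  have Bs: "B (s n) = entire_ball (f n) (R n) (\<delta> n)" for n
    by (simp add: B_def f_def R_def \<delta>_def split: prod.split)
  have Ps: "f n \<in> entire_functions \<and> real n \<le> R n \<and> 0 < \<delta> n \<and> \<delta> n \<le> 1 / (real n + 1)" for n
    using s(1)[of n] by (simp add: P_def f_def R_def \<delta>_def split: prod.splits)
  have dec: "B (s m) \<subseteq> B (s n)" if "n \<le> m" for m n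
    using that by (induction rule: dec_induct) (use s(2) in blast)+
  have "f m \<in> entire_ball (f n) (R n) (\<delta> n)" if "n \<le> m" for m n
  proof -
    have "f m \<in> B (s m)" using Ps[of m] unfolding Bs by (auto simp: entire_ball_def)
    then show ?thesis using dec[OF that] unfolding Bs by blast
  qed
  moreover have "\<delta> \<longlonglongrightarrow> 0"
  proof (rule tendsto_sandwich)
    show "(\<lambda>n. 0::real) \<longlonglongrightarrow> 0" "(\<lambda>n. 1 / (real n + 1)) \<longlonglongrightarrow> 0" by real_asymp+
  qed (use Ps in \<open>auto intro!: always_eventually simp: less_imp_le\<close>)
  moreover have "real n \<le> R n" for n using Ps by blast
  ultimately obtain F where F: "F \<in> entire_functions" "\<And>n. F \<in> entire_ball (f n) (R n) (\<delta> n)"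
    using entire_ball_limit[of f R \<delta>] by blast
  have "F \<in> G n" for n using F(2)[of "Suc n"] s(2)[of n] unfolding Bs by blast
  moreover have "\<exists>n. H = G n" if "H \<in> \<G>" for H
    using that from_nat_into_surj[OF assms(1) that] unfolding G_def by metis
  ultimately show ?thesis using F(1) by metis
qed

text \<open>
  By the Cauchy estimates on a disc of twice the radius, the Taylor series converges uniformly.
\<close>
lemma entire_polynomial_approximation:
  assumes "g \<in> entire_functions" "0 < \<epsilon>"
  shows "\<exists>p :: complex poly. \<forall>z\<in>cball 0 R. norm (poly p z - g z) < \<epsilon>"
proof -
  define r where "r = \<bar>R\<bar> + 1"
  have r: "r > 0" "R \<le> r" by (auto simp: r_def)
  obtain M where M: "0 < M" "\<And>z. z \<in> cball 0 (2*r) \<Longrightarrow> norm (g z) \<le> M"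
    using entire_functions_bounded[OF assms(1)] by blast
  define a where "a n = (deriv ^^ n) g 0 / fact n" for n
  have hol: "g holomorphic_on S" for S
    using assms(1) unfolding entire_functions_holomorphic by (meson holomorphic_on_subset subset_UNIV)
  have a: "norm (a n) \<le> M / (2*r)^n" for n
  proof -
    have "norm ((deriv ^^ n) g 0) \<le> fact n * M / (2*r)^n"
      using r M by (intro Cauchy_inequality hol entire_functions_continuous assms(1)) auto
    then show ?thesis by (simp add: a_def norm_divide field_simps)
  qed
  have "uniform_limit (cball 0 R) (\<lambda>n z. \<Sum>i<n. a i * z^i) (\<lambda>z. \<Sum>i. a i * z^i) sequentially"
  proof (rule Weierstrass_m_test)
    show "summable (\<lambda>n. M * (1/2)^n)" by (intro summable_mult summable_geometric) auto
    fix n z assume z: "z \<in> cball (0::complex) R"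
    have "norm (a n * z^n) \<le> M / (2*r)^n * r^n"
      unfolding norm_mult norm_power using a[of n] z r M(1)
      by (intro mult_mono power_mono divide_nonneg_nonneg) auto
    also have "\<dots> = M * (1/2)^n" using r by (simp add: power_mult_distrib field_simps)
    finally show "norm (a n * z^n) \<le> M * (1/2)^n" .
  qed
  moreover have "(\<Sum>i. a i * z^i) = g z" for z
  proof -
    have "(\<lambda>n. (deriv ^^ n) g 0 / fact n * (z - 0)^n) sums g z"
      by (rule holomorphic_power_series[of g 0 "norm z + 1"]) (auto intro: hol)
    then show ?thesis by (simp add: a_def sums_iff)
  qed
  ultimately have "uniform_limit (cball 0 R) (\<lambda>n z. \<Sum>i<n. a i * z^i) g sequentially" by simp
  then have "\<forall>\<^sub>F n in sequentially. \<forall>z\<in>cball 0 R. dist (\<Sum>i<n. a i * z^i) (g z) < \<epsilon>"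
    using assms(2) by (rule uniform_limitD)
  then obtain n where n: "\<forall>z\<in>cball 0 R. dist (\<Sum>i<n. a i * z^i) (g z) < \<epsilon>"
    using eventually_happens'[OF sequentially_bot] by blast
  have "poly (\<Sum>i<n. monom (a i) i) z = (\<Sum>i<n. a i * z^i)" for z
    by (simp add: poly_sum poly_monom)
  with n have "\<forall>z\<in>cball 0 R. norm (poly (\<Sum>i<n. monom (a i) i) z - g z) < \<epsilon>"
    by (simp add: dist_norm)
  then show ?thesis by blast
qed

lemma countable_dense_entire_functions:
  obtains Q where "countable Q" "Q \<subseteq> entire_functions"
    "\<And>g R \<epsilon>. g \<in> entire_functions \<Longrightarrow> 0 < \<epsilon> \<Longrightarrow> \<exists>q\<in>Q. \<forall>z\<in>cball 0 R. norm (q z - g z) < \<epsilon>"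
proof -
  obtain D :: "complex set" where D: "countable D" "\<And>X. open X \<Longrightarrow> X \<noteq> {} \<Longrightarrow> \<exists>d\<in>D. d \<in> X"
    by (rule countable_dense_setE) blast
  \<comment> \<open>Polynomials with coefficients in a countable dense set of complex numbers.\<close>
  define Q where "Q = (\<lambda>xs z. poly (Poly xs) z) ` lists D"
  show ?thesis
  proof (rule that)
    show "countable Q" unfolding Q_def using D(1) by simp
    show "Q \<subseteq> entire_functions"
      unfolding Q_def entire_functions_def by (auto intro!: holomorphic_intros)
    fix g R and \<epsilon> :: real assume g: "g \<in> entire_functions" "0 < \<epsilon>"
    obtain p where p: "\<forall>z\<in>cball 0 R. norm (poly p z - g z) < \<epsilon>/2"
      using entire_polynomial_approximation[OF g(1), of "\<epsilon>/2"] g(2) by auto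
    define r where "r = \<bar>R\<bar> + 1"
    define n where "n = Suc (degree p)"
    define \<eta> where "\<eta> = \<epsilon> / (2 * (\<Sum>i<n. r^i))"
    have sum: "(\<Sum>i<n. r^i) > 0" unfolding n_def r_def by (intro sum_pos) auto
    have \<eta>: "\<eta> > 0" using sum g by (simp add: \<eta>_def)
    have "\<forall>i. \<exists>d. d \<in> D \<and> norm (coeff p i - d) < \<eta>"
      using D(2)[of "ball (coeff p i) \<eta>" for i] \<eta> by (force simp: dist_norm)
    from choice[OF this] obtain d where d: "\<And>i. d i \<in> D" "\<And>i. norm (coeff p i - d i) < \<eta>"
      by blast
    define q where "q = Poly (map d [0..<n])"
    have q: "poly q z = (\<Sum>i<n. d i * z^i)" for z
    proof -
      have "q = (\<Sum>i<n. monom (d i) i)"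
        by (rule poly_eqI) (auto simp: q_def coeff_sum nth_default_def coeff_Poly_eq if_distrib cong: if_cong)
      then show ?thesis by (simp add: poly_sum poly_monom)
    qed
    have pz: "poly p z = (\<Sum>i<n. coeff p i * z^i)" for z
      by (simp add: poly_altdef n_def lessThan_Suc_atMost)
    have "norm (poly q z - g z) < \<epsilon>" if z: "z \<in> cball 0 R" for z
    proof -
      have "norm (poly q z - poly p z) = norm (\<Sum>i<n. (d i - coeff p i) * z^i)"
        by (simp add: q pz sum_subtractf[symmetric] left_diff_distrib)
      also have "\<dots> \<le> (\<Sum>i<n. \<eta> * r^i)"
      proof (rule sum_norm_le)
        fix i
        have "norm (d i - coeff p i) \<le> \<eta>" "norm z \<le> r"
          using d(2)[of i] z by (auto simp: norm_minus_commute r_def)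
        then show "norm ((d i - coeff p i) * z^i) \<le> \<eta> * r^i"
          unfolding norm_mult norm_power using \<eta> by (intro mult_mono power_mono) auto
      qed
      also have "\<dots> = \<eta> * (\<Sum>i<n. r^i)" by (rule sum_distrib_left[symmetric])
      also have "\<dots> = \<epsilon>/2" using sum by (simp add: \<eta>_def)
      finally have "norm (poly q z - poly p z) \<le> \<epsilon>/2" .
      moreover have "norm (poly p z - g z) < \<epsilon>/2" using p z by blast
      ultimately show ?thesis
        using norm_triangle_ineq[of "poly q z - poly p z" "poly p z - g z"] by simp
    qed
    moreover have "(\<lambda>z. poly q z) \<in> Q" unfolding Q_def q_def
      by (rule image_eqI[where x = "map d [0..<n]"]) (use d in auto)
    ultimately show "\<exists>q\<in>Q. \<forall>z\<in>cball 0 R. norm (q z - g z) < \<epsilon>" by blast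
  qed
qed

section \<open>Operators of infinite order on entire functions\<close>

text \<open>
  The bound is continuity for the compact-open topology in a form that composes: the constant $C$ and
  the enlargement $\rho$ of the disc do not depend on the disc.
\<close>
locale entire_operator =
  fixes T :: "(complex \<Rightarrow> complex) \<Rightarrow> complex \<Rightarrow> complex"
  assumes entire: "f \<in> entire_functions \<Longrightarrow> T f \<in> entire_functions"
    and add: "f \<in> entire_functions \<Longrightarrow> g \<in> entire_functions \<Longrightarrow>
      T (\<lambda>z. f z + g z) = (\<lambda>z. T f z + T g z)"
    and scale: "f \<in> entire_functions \<Longrightarrow> T (\<lambda>z. c * f z) = (\<lambda>z. c * T f z)"
    and bound: "\<exists>C \<rho>. 0 < C \<and> 0 \<le> \<rho> \<and> (\<forall>f\<in>entire_functions. \<forall>R M.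
      (\<forall>z\<in>cball 0 (R + \<rho>). norm (f z) \<le> M) \<longrightarrow> (\<forall>z\<in>cball 0 R. norm (T f z) \<le> C * M))"
begin

lemma zero: "T (\<lambda>z. 0) = (\<lambda>z. 0)"
proof -
  have "(\<lambda>z. 0) \<in> entire_functions" by (simp add: entire_functions_def)
  from scale[OF this, of 0] show ?thesis by simp
qed

lemma linear_combination:
  assumes "finite I" "\<And>i. i \<in> I \<Longrightarrow> f i \<in> entire_functions"
  shows "T (\<lambda>z. \<Sum>i\<in>I. c i * f i z) = (\<lambda>z. \<Sum>i\<in>I. c i * T (f i) z)"
  using assms
proof (induction I rule: finite_induct)
  case empty
  then show ?case by (simp add: zero)
next
  case (insert x F)
  have "(\<lambda>z. \<Sum>i\<in>F. c i * f i z) \<in> entire_functions" "(\<lambda>z. c x * f x z) \<in> entire_functions"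
    using insert.prems entire_functions_sum[of F f c] entire_functions_sum[of "{x}" f c] by simp_all
  then show ?case using insert by (simp add: add scale)
qed

lemma diff:
  assumes "f \<in> entire_functions" "g \<in> entire_functions"
  shows "T (\<lambda>z. f z - g z) = (\<lambda>z. T f z - T g z)"
proof -
  have g: "(\<lambda>z. (-1) * g z) \<in> entire_functions"
    using entire_functions_sum[of "{g}" id "\<lambda>_. -1"] assms by simp
  show ?thesis using add[OF assms(1) g] scale[OF assms(2), of "-1"] by simp
qed

lemma power_continuous:
  assumes f: "f \<in> entire_functions" and \<epsilon>: "0 < \<epsilon>"
  shows "\<exists>R' \<delta>. 0 < \<delta> \<and> (\<forall>g\<in>entire_ball f R' \<delta>. \<forall>z\<in>cball 0 R.
           norm (T (\<lambda>z. g z ^ j) z - T (\<lambda>z. f z ^ j) z) \<le> \<epsilon>)"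
proof -
  obtain C \<rho> where C: "0 < C" "0 \<le> \<rho>"
    and bd: "\<And>f R M z. f \<in> entire_functions \<Longrightarrow> \<forall>z\<in>cball 0 (R + \<rho>). norm (f z) \<le> M \<Longrightarrow>
               z \<in> cball 0 R \<Longrightarrow> norm (T f z) \<le> C * M"
    using bound by blast
  obtain M where M: "0 < M" "\<And>z. z \<in> cball 0 (R + \<rho>) \<Longrightarrow> norm (f z) \<le> M"
    using entire_functions_bounded[OF f] by metis
  have "uniformly_continuous_on (cball 0 (M+1)) (\<lambda>w::complex. w ^ j)"
    by (intro compact_uniformly_continuous continuous_intros compact_cball)
  moreover have "0 < \<epsilon> / C" using C \<epsilon> by simp
  ultimately obtain d where d: "d > 0" "\<And>w w'. w \<in> cball 0 (M+1) \<Longrightarrow> w' \<in> cball 0 (M+1) \<Longrightarrow>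
      dist w' w < d \<Longrightarrow> dist (w' ^ j) (w ^ j :: complex) < \<epsilon> / C"
    unfolding uniformly_continuous_on_def by metis
  have "norm (T (\<lambda>z. g z ^ j) z - T (\<lambda>z. f z ^ j) z) \<le> \<epsilon>"
    if g: "g \<in> entire_ball f (R + \<rho>) (min 1 (d/2))" and z: "z \<in> cball 0 R" for g z
  proof -
    have pow: "(\<lambda>z. h z ^ j) \<in> entire_functions" if "h \<in> entire_functions" for h
      using that unfolding entire_functions_holomorphic by (intro holomorphic_intros)
    have gE: "g \<in> entire_functions" using g by (simp add: entire_ball_def)
    have close: "norm (g y ^ j - f y ^ j) \<le> \<epsilon> / C" if y: "y \<in> cball 0 (R + \<rho>)" for y
    proof -
      have gy: "norm (g y - f y) \<le> min 1 (d/2)" using g y by (auto simp: entire_ball_def)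
      have fy: "norm (f y) \<le> M" using M y by blast
      have "norm (g y) \<le> M + 1" using gy fy norm_triangle_ineq2[of "g y" "f y"] by simp
      then have "dist (g y ^ j) (f y ^ j) < \<epsilon> / C"
        using gy fy d(1) by (intro d(2)) (auto simp: dist_norm)
      then show ?thesis by (simp add: dist_norm)
    qed
    have "(\<lambda>z. g z ^ j - f z ^ j) \<in> entire_functions"
      using pow[OF gE] pow[OF f] unfolding entire_functions_holomorphic by (rule holomorphic_on_diff)
    then have "norm (T (\<lambda>z. g z ^ j - f z ^ j) z) \<le> C * (\<epsilon> / C)"
      using close z by (intro bd) auto
    then show ?thesis using C by (simp add: diff pow gE f)
  qed
  then show ?thesis using d(1) by (intro exI[of _ "R + \<rho>"] exI[of _ "min 1 (d/2)"]) auto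
qed

lemma iterate: "entire_operator (T ^^ N)"
proof (induction N)
  case 0
  have "\<exists>C \<rho>. 0 < C \<and> 0 \<le> \<rho> \<and> (\<forall>f\<in>entire_functions. \<forall>R M.
      (\<forall>z\<in>cball 0 (R + \<rho>). norm (f z) \<le> M) \<longrightarrow> (\<forall>z\<in>cball 0 R. norm ((T ^^ 0) f z) \<le> C * M))"
    by (rule exI[of _ 1], rule exI[of _ 0]) auto
  then show ?case by unfold_locales simp_all
next
  case (Suc N)
  interpret N: entire_operator "T ^^ N" by fact
  show ?case
  proof unfold_locales
    obtain C \<rho> where C: "0 < C" "0 \<le> \<rho>"
      and bd: "\<And>f R M z. f \<in> entire_functions \<Longrightarrow> \<forall>z\<in>cball 0 (R + \<rho>). norm (f z) \<le> M \<Longrightarrow>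
               z \<in> cball 0 R \<Longrightarrow> norm (T f z) \<le> C * M"
      using bound by blast
    obtain C' \<rho>' where C': "0 < C'" "0 \<le> \<rho>'"
      and bd': "\<And>f R M z. f \<in> entire_functions \<Longrightarrow> \<forall>z\<in>cball 0 (R + \<rho>'). norm (f z) \<le> M \<Longrightarrow>
               z \<in> cball 0 R \<Longrightarrow> norm ((T ^^ N) f z) \<le> C' * M"
      using N.bound by blast
    have "norm ((T ^^ Suc N) f z) \<le> (C * C') * M"
      if "f \<in> entire_functions" "\<forall>z\<in>cball 0 (R + (\<rho> + \<rho>')). norm (f z) \<le> M" "z \<in> cball 0 R" for f R M z
    proof -
      have "\<forall>z\<in>cball 0 (R + \<rho>). norm ((T ^^ N) f z) \<le> C' * M"
        using that by (auto intro!: bd' simp: add.assoc)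
      then show ?thesis using bd[of "(T ^^ N) f" R "C' * M" z] that by (simp add: N.entire mult.assoc)
    qed
    then show "\<exists>C \<rho>. 0 < C \<and> 0 \<le> \<rho> \<and> (\<forall>f\<in>entire_functions. \<forall>R M.
      (\<forall>z\<in>cball 0 (R + \<rho>). norm (f z) \<le> M) \<longrightarrow> (\<forall>z\<in>cball 0 R. norm ((T ^^ Suc N) f z) \<le> C * M))"
      using C C' by (intro exI[of _ "C * C'"] exI[of _ "\<rho> + \<rho>'"]) auto
  qed (simp_all add: N.entire entire N.add add N.scale scale)
qed

lemma iterate_eigenvector:
  assumes "e \<in> entire_functions" "T e = (\<lambda>z. \<mu> * e z)"
  shows "(T ^^ N) e = (\<lambda>z. \<mu> ^ N * e z)"
proof (induction N)
  case (Suc N)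
  have "(T ^^ Suc N) e = T (\<lambda>z. \<mu> ^ N * e z)" by (simp add: Suc)
  also have "\<dots> = (\<lambda>z. \<mu> ^ N * (\<mu> * e z))" by (simp add: scale assms)
  finally show ?case by (simp add: mult_ac)
qed simp

end

text \<open>
  The Cauchy estimate for the $n$-th derivative on the circle of radius $n/B$, which is the optimal
  radius for the bound $A e^{B|z|}$, together with $n! \le n^n$.
\<close>
lemma exponential_type_coefficient_bound:
  assumes hol: "\<Phi> holomorphic_on UNIV" and "exponential_type \<Phi>"
  obtains A K where "0 < A" "0 < K" "\<And>n. norm ((deriv ^^ n) \<Phi> 0) \<le> A * K ^ n"
proof -
  obtain A B where AB: "\<And>z. norm (\<Phi> z) \<le> A * exp (B * norm z)"
    using assms(2) unfolding exponential_type_def by blast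
  define A' where "A' = \<bar>A\<bar> + 1"
  define B' where "B' = \<bar>B\<bar> + 1"
  have pos: "0 < A'" "0 < B'" by (auto simp: A'_def B'_def)
  have AB': "norm (\<Phi> z) \<le> A' * exp (B' * norm z)" for z
    using AB[of z] by (rule order_trans) (auto simp: A'_def B'_def intro!: mult_mono mult_right_mono)
  have hol': "\<Phi> holomorphic_on S" for S using hol by (rule holomorphic_on_subset) auto
  have cont: "continuous_on S \<Phi>" for S using hol' by (rule holomorphic_on_imp_continuous_on)
  have "norm ((deriv ^^ n) \<Phi> 0) \<le> A' * (B' * exp 1) ^ n" for n
  proof (cases "n = 0")
    case True
    then show ?thesis using AB'[of 0] by simp
  next
    case False
    define r where "r = real n / B'"
    have r: "r > 0" using False pos by (simp add: r_def)
    have "norm ((deriv ^^ n) \<Phi> 0) \<le> fact n * (A' * exp (B' * r)) / r ^ n"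
    proof (rule Cauchy_inequality[OF hol' cont r])
      fix x :: complex assume "norm (0 - x) = r"
      then show "norm (\<Phi> x) \<le> A' * exp (B' * r)" using AB'[of x] by simp
    qed
    also have "\<dots> \<le> real n ^ n * (A' * exp (B' * r)) / r ^ n"
      using r pos fact_le_power[of n, where ?'a = real]
      by (intro divide_right_mono mult_right_mono) (auto simp flip: of_nat_power)
    also have "\<dots> = A' * (B' * exp 1) ^ n"
      using False pos by (simp add: r_def power_mult_distrib power_divide exp_of_nat_mult[symmetric] field_simps)
    finally show ?thesis .
  qed
  then show ?thesis using pos by (intro that[of A' "B' * exp 1"]) auto
qed

lemma entire_deriv_bound:
  assumes f: "f \<in> entire_functions" and "0 < \<rho>"
    and "\<And>y. y \<in> cball z \<rho> \<Longrightarrow> norm (f y) \<le> M"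
  shows "norm ((deriv ^^ n) f z) \<le> fact n * M / \<rho> ^ n"
proof (rule Cauchy_inequality)
  show "f holomorphic_on ball z \<rho>" using f unfolding entire_functions_holomorphic
    by (rule holomorphic_on_subset) auto
qed (use assms in \<open>auto intro: entire_functions_continuous simp: dist_norm\<close>)

text \<open>
  With $|\Phi^{(n)}(0)| \le A K^n$, enlarging the disc by $2K$ in the Cauchy estimates for
  $f^{(n)}$ dominates the series by a geometric series of ratio $1/2$. This gives convergence, uniform
  on discs, and the bound with $C = 2A$.
\<close>
lemma entire_operator_diff_operator:
  assumes "\<Phi> holomorphic_on UNIV" "exponential_type \<Phi>"
  shows "entire_operator (diff_operator \<Phi>)"
proof -
  obtain A K where AK: "0 < A" "0 < K" "\<And>n. norm ((deriv ^^ n) \<Phi> 0) \<le> A * K ^ n"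
    by (rule exponential_type_coefficient_bound[OF assms], rule that)
  define b where "b n = (deriv ^^ n) \<Phi> 0 / fact n" for n
  have T: "diff_operator \<Phi> f = (\<lambda>z. \<Sum>n. b n * (deriv ^^ n) f z)" for f
    by (simp add: diff_operator_def b_def)
  have term_bound: "norm (b n * (deriv ^^ n) f z) \<le> A * M * (1/2) ^ n"
    if "f \<in> entire_functions" "\<forall>z\<in>cball 0 (R + 2*K). norm (f z) \<le> M" "z \<in> cball 0 R" for f R M z n
  proof -
    have "norm ((deriv ^^ n) f z) \<le> fact n * M / (2*K) ^ n"
    proof (rule entire_deriv_bound[OF that(1)])
      fix y assume "y \<in> cball z (2*K)"
      then have "norm y \<le> R + 2*K"
        using norm_triangle_ineq2[of y z] that(3) by (simp add: dist_norm norm_minus_commute)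
      then show "norm (f y) \<le> M" using that(2) by simp
    qed (use AK in simp)
    then have "norm (b n * (deriv ^^ n) f z) \<le> (A * K ^ n / fact n) * (fact n * M / (2*K) ^ n)"
      unfolding norm_mult b_def norm_divide using AK
      by (intro mult_mono) (auto simp: divide_right_mono)
    also have "\<dots> = A * M * (1/2) ^ n"
      using AK by (simp add: power_mult_distrib field_simps)
    finally show ?thesis .
  qed
  have geo: "summable (\<lambda>n. A * M * (1/2) ^ n)" "(\<Sum>n. A * M * (1/2) ^ n) = 2 * A * M" for M
    using suminf_geometric[of "1/2::real"] by (simp_all add: suminf_mult summable_geometric)
  have sm: "summable (\<lambda>n. b n * (deriv ^^ n) f z)" if f: "f \<in> entire_functions" for f z
  proof -
    obtain M where "\<And>y. y \<in> cball 0 (norm z + 2*K) \<Longrightarrow> norm (f y) \<le> M"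
      using entire_functions_bounded[OF f] by metis
    then have "norm (b n * (deriv ^^ n) f z) \<le> A * M * (1/2) ^ n" for n
      by (intro term_bound[where R = "norm z"] f) auto
    then show ?thesis by (rule summable_comparison_test'[OF geo(1)])
  qed
  show ?thesis
  proof unfold_locales
    fix f assume f: "f \<in> entire_functions"
    have hf: "f holomorphic_on UNIV" using f by (simp add: entire_functions_holomorphic)
    show "diff_operator \<Phi> f \<in> entire_functions"
      unfolding entire_functions_holomorphic T
    proof (rule holomorphic_uniform_sequence[OF open_UNIV])
      show "(\<lambda>z. \<Sum>i<n. b i * (deriv ^^ i) f z) holomorphic_on UNIV" for n
        by (intro holomorphic_intros holomorphic_higher_deriv hf) auto
      fix x :: complex
      obtain M where "\<And>y. y \<in> cball 0 (norm x + 1 + 2*K) \<Longrightarrow> norm (f y) \<le> M"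
        using entire_functions_bounded[OF f] by metis
      then have "norm (b n * (deriv ^^ n) f y) \<le> A * M * (1/2) ^ n" if "y \<in> cball x 1" for n y
        using that norm_triangle_ineq2[of y x]
        by (intro term_bound[where R = "norm x + 1"] f) (auto simp: dist_norm norm_minus_commute)
      then have "uniform_limit (cball x 1) (\<lambda>n z. \<Sum>i<n. b i * (deriv ^^ i) f z)
          (\<lambda>z. \<Sum>n. b n * (deriv ^^ n) f z) sequentially"
        by (rule Weierstrass_m_test[OF _ geo(1)])
      then show "\<exists>d>0. cball x d \<subseteq> UNIV \<and> uniform_limit (cball x d)
          (\<lambda>n z. \<Sum>i<n. b i * (deriv ^^ i) f z) (\<lambda>z. \<Sum>n. b n * (deriv ^^ n) f z) sequentially"
        by (intro exI[of _ 1]) auto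
    qed
    show "diff_operator \<Phi> (\<lambda>z. c * f z) = (\<lambda>z. c * diff_operator \<Phi> f z)" for c
    proof
      fix z
      show "diff_operator \<Phi> (\<lambda>z. c * f z) z = c * diff_operator \<Phi> f z"
        using suminf_mult[OF sm[OF f, of z], of c] unfolding T
        by (simp add: higher_deriv_cmult[OF hf] mult_ac)
    qed
    fix g assume g: "g \<in> entire_functions"
    have hg: "g holomorphic_on UNIV" using g by (simp add: entire_functions_holomorphic)
    show "diff_operator \<Phi> (\<lambda>z. f z + g z) = (\<lambda>z. diff_operator \<Phi> f z + diff_operator \<Phi> g z)"
    proof
      fix z
      show "diff_operator \<Phi> (\<lambda>z. f z + g z) z = diff_operator \<Phi> f z + diff_operator \<Phi> g z"
        using suminf_add[OF sm[OF f, of z] sm[OF g, of z]] unfolding T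
        by (simp add: higher_deriv_add[OF hf hg] algebra_simps)
    qed
  next
    have "norm (diff_operator \<Phi> f z) \<le> 2 * A * M"
      if "f \<in> entire_functions" "\<forall>z\<in>cball 0 (R + 2*K). norm (f z) \<le> M" "z \<in> cball 0 R" for f R M z
    proof -
      have "norm (\<Sum>n. b n * (deriv ^^ n) f z) \<le> (\<Sum>n. A * M * (1/2) ^ n)"
        using term_bound[OF that] by (intro norm_suminf_le geo)
      then show ?thesis by (simp add: T geo(2))
    qed
    then show "\<exists>C \<rho>. 0 < C \<and> 0 \<le> \<rho> \<and> (\<forall>f\<in>entire_functions. \<forall>R M.
      (\<forall>z\<in>cball 0 (R + \<rho>). norm (f z) \<le> M) \<longrightarrow>
      (\<forall>z\<in>cball 0 R. norm (diff_operator \<Phi> f z) \<le> C * M))"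
      using AK by (intro exI[of _ "2*A"] exI[of _ "2*K"]) auto
  qed
qed

lemma higher_deriv_exp_linear:
  "(deriv ^^ n) (\<lambda>z. exp (c * z)) = (\<lambda>z. c ^ n * exp (c * z))" for c :: complex
proof (induction n)
  case (Suc n)
  have "deriv (\<lambda>z. c ^ n * exp (c * z)) z = c ^ Suc n * exp (c * z)" for z
    by (rule DERIV_imp_deriv) (auto intro!: derivative_eq_intros)
  then show ?case using Suc by auto
qed auto

lemma diff_operator_exp:
  assumes "\<Phi> holomorphic_on UNIV"
  shows "diff_operator \<Phi> (\<lambda>z. exp (c * z)) = (\<lambda>z. \<Phi> c * exp (c * z))"
proof
  fix z
  have "(\<lambda>n. (deriv ^^ n) \<Phi> 0 / fact n * (c - 0) ^ n) sums \<Phi> c"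
    by (rule holomorphic_power_series[of \<Phi> 0 "norm c + 1"])
      (auto intro: holomorphic_on_subset[OF assms])
  then have "(\<lambda>n. (deriv ^^ n) \<Phi> 0 / fact n * c ^ n * exp (c * z)) sums (\<Phi> c * exp (c * z))"
    by (intro sums_mult2) simp
  then show "diff_operator \<Phi> (\<lambda>z. exp (c * z)) z = \<Phi> c * exp (c * z)"
    by (simp add: diff_operator_def higher_deriv_exp_linear sums_iff mult.assoc)
qed

section \<open>Density of exponential sums\<close>

text \<open>
  The rate at which $(e^{sz}-1)/s$ tends to $z$ as $s \to 0$.
\<close>
lemma norm_difference_quotient_exp_le:
  fixes s z :: complex
  assumes "s \<noteq> 0" "norm (s * z) \<le> 1"
  shows "norm ((exp (s * z) - 1) / s - z) \<le> 3 * norm s * (norm z)\<^sup>2"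
proof -
  have "norm (exp (s * z) - (\<Sum>i\<le>1. (s * z) ^ i / fact i)) \<le> exp (norm (s * z)) * norm (s * z) ^ Suc 1 / fact 1"
    by (rule Taylor_exp_field)
  also have "\<dots> \<le> exp 1 * (norm (s * z))\<^sup>2"
    using assms(2) by (simp add: power2_eq_square mult_right_mono)
  also have "\<dots> \<le> 3 * (norm (s * z))\<^sup>2"
    by (intro mult_right_mono exp_le) auto
  finally have "norm (exp (s * z) - 1 - s * z) \<le> 3 * (norm (s * z))\<^sup>2"
    by (simp add: algebra_simps)
  moreover have "(exp (s * z) - 1) / s - z = (exp (s * z) - 1 - s * z) / s"
    using assms(1) by (simp add: field_simps)
  ultimately show ?thesis using assms(1)
    by (simp add: norm_divide norm_mult power2_eq_square field_simps)
qed

text \<open>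
  After division by $e^{\kappa z}$ the function is close to a polynomial $p(z)$, hence to
  $p((e^{sz}-1)/s)$ for a small multiple $s$ of $d$. The latter is a polynomial in $e^{sz}$ of the same degree, and
  multiplying it by $e^{\kappa z}$ gives a sum over the frequencies $\kappa + ks$.
\<close>
lemma exponential_sums_dense:
  assumes g: "g \<in> entire_functions" and \<epsilon>: "0 < \<epsilon>" and d: "d \<noteq> 0" and \<eta>: "0 < \<eta>"
    and S: "(\<lambda>t. \<kappa> + of_real t * d) ` {0..<\<eta>} \<subseteq> S"
  shows "\<exists>\<Lambda> c. finite \<Lambda> \<and> \<Lambda> \<subseteq> S \<and>
    (\<forall>z\<in>cball 0 R. norm ((\<Sum>\<nu>\<in>\<Lambda>. c \<nu> * exp (\<nu> * z)) - g z) < \<epsilon>)"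
proof -
  have "(\<lambda>z. exp (\<kappa> * z)) \<in> entire_functions"
    by (auto simp: entire_functions_def intro!: holomorphic_intros)
  then obtain M where M: "0 < M" "\<And>z. z \<in> cball 0 R \<Longrightarrow> norm (exp (\<kappa> * z)) \<le> M"
    by (rule entire_functions_bounded) blast
  define \<epsilon>' where "\<epsilon>' = \<epsilon> / (2 * M)"
  have \<epsilon>': "\<epsilon>' > 0" using \<epsilon> M by (simp add: \<epsilon>'_def)
  have "(\<lambda>z. g z * exp (- \<kappa> * z)) \<in> entire_functions"
    using g unfolding entire_functions_holomorphic by (intro holomorphic_intros)
  from entire_polynomial_approximation[OF this \<epsilon>'] obtain p where
    p: "\<forall>z\<in>cball 0 R. norm (poly p z - g z * exp (- \<kappa> * z)) < \<epsilon>'" by blast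
  define r where "r = \<bar>R\<bar> + 1"
  have r: "r > 0" "R \<le> r" by (auto simp: r_def)
  have "uniformly_continuous_on (cball 0 (r + 1)) (poly p)"
    by (intro compact_uniformly_continuous continuous_intros compact_cball)
  then obtain \<delta> where \<delta>: "\<delta> > 0" "\<And>x y. x \<in> cball 0 (r + 1) \<Longrightarrow> y \<in> cball 0 (r + 1) \<Longrightarrow>
      dist y x < \<delta> \<Longrightarrow> dist (poly p y) (poly p x) < \<epsilon>'"
    unfolding uniformly_continuous_on_def using \<epsilon>' by metis
  define \<delta>' where "\<delta>' = min 1 (\<delta> / 2)"
  have \<delta>': "0 < \<delta>'" "\<delta>' \<le> 1" "\<delta>' < \<delta>" using \<delta> by (auto simp: \<delta>'_def)
  \<comment> \<open>The first bound keeps all frequencies inside the segment, the second makes \<open>s z\<close>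
    small enough for the estimate of the difference quotient, and the third bounds that quotient's
    error by \<open>\<delta>'\<close>.\<close>
  define h where "h = min (\<eta> / (degree p + 1)) (min (1 / (norm d * r)) (\<delta>' / (3 * norm d * r\<^sup>2)))"
  have h: "h > 0" using \<eta> d r \<delta>' by (simp add: h_def)
  define s where "s = of_real h * d"
  have s: "s \<noteq> 0" using h d by (simp add: s_def)
  have sr: "norm s * r \<le> 1" "3 * norm s * r\<^sup>2 \<le> \<delta>'"
  proof -
    have "h \<le> 1 / (norm d * r)" "h \<le> \<delta>' / (3 * norm d * r\<^sup>2)" by (auto simp: h_def)
    then show "norm s * r \<le> 1" "3 * norm s * r\<^sup>2 \<le> \<delta>'"
      using h d r by (simp_all add: s_def norm_mult field_simps)
  qed
  define q where "q = pcompose p [:-1/s, 1/s:]"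
  define n where "n = degree q"
  have n: "n \<le> degree p" using degree_pcompose_le[of p "[:-1/s, 1/s:]"] s by (simp add: q_def n_def)
  define e where "e k = \<kappa> + of_real (real k * h) * d" for k :: nat
  have e_eq: "e k = \<kappa> + of_nat k * s" for k by (simp add: e_def s_def)
  have inj: "inj e" using s by (auto simp: inj_def e_eq)
  have "e k \<in> S" if "k \<le> n" for k
  proof -
    have "real k * h \<le> real (degree p) * (\<eta> / (degree p + 1))"
      using that n h by (intro mult_mono) (auto simp: h_def)
    also have "\<dots> < \<eta>" using \<eta> by (simp add: field_simps)
    finally have "real k * h \<in> {0..<\<eta>}" using h by simp
    then show ?thesis using S unfolding e_def by blast
  qed
  then have sub: "e ` {..n} \<subseteq> S" by auto
  define c where "c \<nu> = coeff q (inv e \<nu>)" for \<nu>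
  have sum_eq: "(\<Sum>\<nu>\<in>e ` {..n}. c \<nu> * exp (\<nu> * z)) = exp (\<kappa> * z) * poly p ((exp (s * z) - 1) / s)" for z
  proof -
    have "(\<Sum>\<nu>\<in>e ` {..n}. c \<nu> * exp (\<nu> * z)) = (\<Sum>k\<le>n. coeff q k * exp (e k * z))"
      using inj by (subst sum.reindex) (auto simp: c_def inj_on_def)
    also have "\<dots> = exp (\<kappa> * z) * (\<Sum>k\<le>n. coeff q k * exp (s * z) ^ k)"
      unfolding sum_distrib_left
      by (intro sum.cong refl) (simp add: e_eq ring_distribs exp_add exp_of_nat_mult[symmetric] mult_ac)
    also have "(\<Sum>k\<le>n. coeff q k * exp (s * z) ^ k) = poly q (exp (s * z))"
      by (simp add: poly_altdef n_def)
    also have "\<dots> = poly p ((exp (s * z) - 1) / s)"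
      by (simp add: q_def poly_pcompose diff_divide_distrib)
    finally show ?thesis .
  qed
  have "norm ((\<Sum>\<nu>\<in>e ` {..n}. c \<nu> * exp (\<nu> * z)) - g z) < \<epsilon>" if z: "z \<in> cball 0 R" for z
  proof -
    let ?y = "(exp (s * z) - 1) / s"
    have nz: "norm z \<le> r" using z r by simp
    have "norm (s * z) \<le> norm s * r" unfolding norm_mult using nz by (intro mult_left_mono) auto
    then have "norm (?y - z) \<le> 3 * norm s * (norm z)\<^sup>2"
      using sr s by (intro norm_difference_quotient_exp_le) auto
    also have "\<dots> \<le> 3 * norm s * r\<^sup>2" using nz by (intro mult_left_mono power_mono) auto
    finally have y: "norm (?y - z) \<le> \<delta>'" using sr by linarith
    then have "norm ?y \<le> r + 1" using nz \<delta>' norm_triangle_ineq2[of ?y z] by linarith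
    then have "dist (poly p ?y) (poly p z) < \<epsilon>'"
      using y \<delta>' nz by (intro \<delta>(2)) (auto simp: dist_norm)
    moreover have "norm (poly p z - g z * exp (- \<kappa> * z)) < \<epsilon>'" using p z by blast
    ultimately have close: "norm (poly p ?y - g z * exp (- \<kappa> * z)) < 2 * \<epsilon>'"
      using norm_triangle_ineq[of "poly p ?y - poly p z" "poly p z - g z * exp (- \<kappa> * z)"]
      by (simp add: dist_norm)
    have "exp (\<kappa> * z) * poly p ?y - g z = exp (\<kappa> * z) * (poly p ?y - g z * exp (- \<kappa> * z))"
      by (simp add: right_diff_distrib exp_minus)
    then have "norm (exp (\<kappa> * z) * poly p ?y - g z) \<le> M * norm (poly p ?y - g z * exp (- \<kappa> * z))"
      using M(2)[OF z] by (simp add: norm_mult mult_right_mono)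
    also have "\<dots> < M * (2 * \<epsilon>')" using close M by simp
    also have "\<dots> = \<epsilon>" using M by (simp add: \<epsilon>'_def)
    finally show ?thesis unfolding sum_eq .
  qed
  then show ?thesis using sub by (intro exI[of _ "e ` {..n}"] exI[of _ c]) auto
qed

section \<open>Powers of exponential sums\<close>

text \<open>
  Expanding over words rather than over multi-indices avoids multinomial coefficients.
\<close>
lemma power_sum_words:
  fixes x :: "'a \<Rightarrow> 'b :: comm_semiring_1"
  assumes "finite S"
  shows "(\<Sum>s\<in>S. x s) ^ j = (\<Sum>p\<in>{..<j} \<rightarrow>\<^sub>E S. \<Prod>i<j. x (p i))"
  using prod_sum_PiE[of "{..<j}" "\<lambda>_. S" "\<lambda>_. x"] assms by simp

lemma exponential_sum_vanishes:
  fixes \<mu> a \<nu> :: "'a \<Rightarrow> complex"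
  assumes "finite W" "\<And>p. p \<in> W \<Longrightarrow> norm (\<mu> p) < 1" "0 < \<epsilon>"
  shows "\<forall>\<^sub>F N in sequentially. \<forall>z\<in>cball 0 R. norm (\<Sum>p\<in>W. a p * \<mu> p ^ N * exp (\<nu> p * z)) < \<epsilon>"
proof -
  define b where "b p = norm (a p) * exp (norm (\<nu> p) * \<bar>R\<bar>)" for p
  have "(\<lambda>N. \<Sum>p\<in>W. b p * norm (\<mu> p) ^ N) \<longlonglongrightarrow> (\<Sum>p\<in>W. b p * 0)"
    using assms(2) by (intro tendsto_sum tendsto_mult tendsto_const LIMSEQ_power_zero) auto
  then have "\<forall>\<^sub>F N in sequentially. (\<Sum>p\<in>W. b p * norm (\<mu> p) ^ N) < \<epsilon>"
    using assms(3) by (intro order_tendstoD(2)[where y = 0]) auto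
  then show ?thesis
  proof eventually_elim
    case (elim N)
    show ?case
    proof
      fix z :: complex assume z: "z \<in> cball 0 R"
      have "norm (\<Sum>p\<in>W. a p * \<mu> p ^ N * exp (\<nu> p * z)) \<le> (\<Sum>p\<in>W. b p * norm (\<mu> p) ^ N)"
      proof (rule sum_norm_le)
        fix p
        have "norm (exp (\<nu> p * z)) \<le> exp (norm (\<nu> p * z))" by (rule norm_exp)
        also have "\<dots> \<le> exp (norm (\<nu> p) * \<bar>R\<bar>)"
          using z by (auto simp: norm_mult intro!: mult_left_mono)
        finally have "norm (a p * \<mu> p ^ N) * norm (exp (\<nu> p * z))
            \<le> norm (a p * \<mu> p ^ N) * exp (norm (\<nu> p) * \<bar>R\<bar>)"
          by (rule mult_left_mono) auto
        then show "norm (a p * \<mu> p ^ N * exp (\<nu> p * z)) \<le> b p * norm (\<mu> p) ^ N"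
          by (simp add: norm_mult norm_power b_def mult_ac)
      qed
      then show "norm (\<Sum>p\<in>W. a p * \<mu> p ^ N * exp (\<nu> p * z)) < \<epsilon>" using elim by linarith
    qed
  qed
qed

context entire_operator
begin

lemma iterate_power_exponential_sum:
  assumes eigen: "\<And>c. T (\<lambda>z. exp (c * z)) = (\<lambda>z. \<Phi> c * exp (c * z))" and "finite S"
  shows "(T ^^ N) (\<lambda>z. (\<Sum>s\<in>S. \<rho> s * \<sigma> s ^ N * exp (s * z)) ^ j) =
    (\<lambda>z. \<Sum>p\<in>{..<j} \<rightarrow>\<^sub>E S. (\<Prod>i<j. \<rho> (p i)) * ((\<Prod>i<j. \<sigma> (p i)) * \<Phi> (\<Sum>i<j. p i)) ^ N
         * exp ((\<Sum>i<j. p i) * z))"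
proof -
  interpret N: entire_operator "T ^^ N" by (rule iterate)
  have exp_entire: "(\<lambda>z. exp (c * z)) \<in> entire_functions" for c
    by (auto simp: entire_functions_def intro!: holomorphic_intros)
  have fin: "finite ({..<j} \<rightarrow>\<^sub>E S)" using assms(2) by (intro finite_PiE) auto
  have expand: "(\<lambda>z. (\<Sum>s\<in>S. \<rho> s * \<sigma> s ^ N * exp (s * z)) ^ j) =
    (\<lambda>z. \<Sum>p\<in>{..<j} \<rightarrow>\<^sub>E S. ((\<Prod>i<j. \<rho> (p i)) * (\<Prod>i<j. \<sigma> (p i)) ^ N) * exp ((\<Sum>i<j. p i) * z))"
    by (simp add: power_sum_words[OF assms(2)] prod.distrib prod_power_distrib exp_sum sum_distrib_right)
  have image: "(T ^^ N) (\<lambda>z. \<Sum>p\<in>{..<j} \<rightarrow>\<^sub>E S. ((\<Prod>i<j. \<rho> (p i)) * (\<Prod>i<j. \<sigma> (p i)) ^ N) *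
      exp ((\<Sum>i<j. p i) * z)) = (\<lambda>z. \<Sum>p\<in>{..<j} \<rightarrow>\<^sub>E S. ((\<Prod>i<j. \<rho> (p i)) * (\<Prod>i<j. \<sigma> (p i)) ^ N) *
      (\<Phi> (\<Sum>i<j. p i) ^ N * exp ((\<Sum>i<j. p i) * z)))"
    (is "_ = (\<lambda>z. \<Sum>p\<in>?W. ?c p * _ p z)")
  proof -
    have eig: "(T ^^ N) (\<lambda>z. exp (c * z)) = (\<lambda>z. \<Phi> c ^ N * exp (c * z))" for c
      by (rule iterate_eigenvector[OF exp_entire eigen])
    show ?thesis
      using N.linear_combination[of ?W "\<lambda>p z. exp ((\<Sum>i<j. p i) * z)" ?c, OF fin exp_entire]
      unfolding eig .
  qed
  show ?thesis unfolding expand image by (simp only: power_mult_distrib mult.assoc)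
qed

text \<open>
  The frequencies in \<open>B\<close> carry coefficients $\rho_s \sigma_s^N$ that tend to $0$, so $f$
  stays near the sum over \<open>\<Gamma>\<close>; but $\sigma_s^m$ is exactly the inverse of the
  eigenvalue of $e^{msz}$, so the $m$-th power of such a term is carried by $T^N$ to $\rho_s^m e^{msz}$ for
  every \<open>N\<close>. All other words contribute sequences that tend to $0$ by
  \<open>small\<close>.
\<close>
lemma constant_words_dominate:
  fixes \<Phi> \<rho> \<sigma> v :: "complex \<Rightarrow> complex"
  assumes eigen: "\<And>c. T (\<lambda>z. exp (c * z)) = (\<lambda>z. \<Phi> c * exp (c * z))"
    and fin: "finite \<Gamma>" "finite B" and disj: "\<Gamma> \<inter> B = {}" and m: "1 \<le> m"
    and \<Gamma>: "\<And>s. s \<in> \<Gamma> \<Longrightarrow> \<sigma> s = 1"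
    and B: "\<And>s. s \<in> B \<Longrightarrow> norm (\<sigma> s) < 1"
      "\<And>s. s \<in> B \<Longrightarrow> \<sigma> s ^ m * \<Phi> (of_nat m * s) = 1" "\<And>s. s \<in> B \<Longrightarrow> \<rho> s ^ m = v s"
    and small: "\<And>j p. 1 \<le> j \<Longrightarrow> j \<le> m \<Longrightarrow> p \<in> {..<j} \<rightarrow>\<^sub>E (\<Gamma> \<union> B) \<Longrightarrow>
      \<not> (j = m \<and> (\<exists>s\<in>B. p = (\<lambda>i\<in>{..<m}. s))) \<Longrightarrow>
      norm ((\<Prod>i<j. \<sigma> (p i)) * \<Phi> (\<Sum>i<j. p i)) < 1"
    and \<epsilon>: "0 < \<epsilon>"
  shows "\<exists>N. \<exists>f\<in>entire_functions. \<forall>z\<in>cball 0 R.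
    norm (f z - (\<Sum>s\<in>\<Gamma>. \<rho> s * exp (s * z))) < \<epsilon> \<and>
    (\<forall>j\<in>{1..<m}. norm ((T ^^ N) (\<lambda>z. f z ^ j) z) < \<epsilon>) \<and>
    norm ((T ^^ N) (\<lambda>z. f z ^ m) z - (\<Sum>s\<in>B. v s * exp (of_nat m * s * z))) < \<epsilon>"
proof -
  define S where "S = \<Gamma> \<union> B"
  have finS: "finite S" using fin by (simp add: S_def)
  define f where "f N z = (\<Sum>s\<in>S. \<rho> s * \<sigma> s ^ N * exp (s * z))" for N and z
  define \<mu> where "\<mu> j p = (\<Prod>i<j. \<sigma> (p i)) * \<Phi> (\<Sum>i<j. p i)" for j and p :: "nat \<Rightarrow> complex"
  define W where "W j = ({..<j} \<rightarrow>\<^sub>E S)" for j :: nat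
  define C where "C = (\<lambda>s. \<lambda>i\<in>{..<m}. s) ` B"
  define A where "A j p N z = (\<Prod>i<j. \<rho> (p i)) * \<mu> j p ^ N * exp ((\<Sum>i<j. p i) * z)"
    for j and p :: "nat \<Rightarrow> complex" and N z
  have finW: "finite (W j)" for j unfolding W_def using finS by (intro finite_PiE) auto
  have image: "(T ^^ N) (\<lambda>z. f N z ^ j) z = (\<Sum>p\<in>W j. A j p N z)" for N j z
    unfolding f_def iterate_power_exponential_sum[OF eigen finS] W_def A_def \<mu>_def ..
  have CW: "C \<subseteq> W m" by (auto simp: C_def W_def S_def PiE_def extensional_def)
  have diag: "(\<Sum>p\<in>C. A m p N z) = (\<Sum>s\<in>B. v s * exp (of_nat m * s * z))" for N z
  proof -
    have "inj_on (\<lambda>s. \<lambda>i\<in>{..<m}. s) B"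
    proof (rule inj_onI)
      fix x y assume "(\<lambda>i\<in>{..<m}. x) = (\<lambda>i\<in>{..<m}. y)"
      from fun_cong[OF this, of 0] show "x = y" using m by simp
    qed
    then have "(\<Sum>p\<in>C. A m p N z) = (\<Sum>s\<in>B. A m (\<lambda>i\<in>{..<m}. s) N z)"
      unfolding C_def by (simp add: sum.reindex)
    also have "\<dots> = (\<Sum>s\<in>B. v s * exp (of_nat m * s * z))"
      by (intro sum.cong refl) (simp add: A_def \<mu>_def B)
    finally show ?thesis .
  qed
  have lower: "\<forall>\<^sub>F N in sequentially. \<forall>z\<in>cball 0 R. norm ((T ^^ N) (\<lambda>z. f N z ^ j) z) < \<epsilon>"
    if j: "j \<in> {1..<m}" for j
  proof -
    have "norm (\<mu> j p) < 1" if "p \<in> W j" for p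
      using that j unfolding \<mu>_def W_def S_def by (intro small) auto
    then show ?thesis unfolding image unfolding A_def
      by (rule exponential_sum_vanishes[OF finW[of j] _ \<epsilon>])
  qed
  have offdiag: "norm (\<mu> m p) < 1" if "p \<in> W m - C" for p
    using that m unfolding \<mu>_def W_def C_def S_def by (intro small) auto
  have rest: "(T ^^ N) (\<lambda>z. f N z ^ m) z - (\<Sum>s\<in>B. v s * exp (of_nat m * s * z)) =
      (\<Sum>p\<in>W m - C. A m p N z)" for N z
    unfolding image by (simp only: sum_diff[OF finW CW] diag)
  have top: "\<forall>\<^sub>F N in sequentially. \<forall>z\<in>cball 0 R.
      norm ((T ^^ N) (\<lambda>z. f N z ^ m) z - (\<Sum>s\<in>B. v s * exp (of_nat m * s * z))) < \<epsilon>"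
    unfolding rest unfolding A_def
    by (rule exponential_sum_vanishes[OF finite_Diff[OF finW[of m]] offdiag \<epsilon>])
  have "f N z - (\<Sum>s\<in>\<Gamma>. \<rho> s * exp (s * z)) = (\<Sum>s\<in>B. \<rho> s * \<sigma> s ^ N * exp (s * z))" for N z
    unfolding f_def S_def sum.union_disjoint[OF fin disj] by (simp add: \<Gamma>)
  then have base: "\<forall>\<^sub>F N in sequentially. \<forall>z\<in>cball 0 R.
      norm (f N z - (\<Sum>s\<in>\<Gamma>. \<rho> s * exp (s * z))) < \<epsilon>"
    using exponential_sum_vanishes[OF fin(2) B(1) \<epsilon>, where R = R and a = \<rho> and \<nu> = "\<lambda>s. s"] by simp
  have "\<forall>\<^sub>F N in sequentially. \<forall>j\<in>{1..<m}. \<forall>z\<in>cball 0 R. norm ((T ^^ N) (\<lambda>z. f N z ^ j) z) < \<epsilon>"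
    using lower by (intro eventually_ball_finite) auto
  from eventually_conj[OF base eventually_conj[OF this top]] obtain N where
    "(\<forall>z\<in>cball 0 R. norm (f N z - (\<Sum>s\<in>\<Gamma>. \<rho> s * exp (s * z))) < \<epsilon>) \<and>
     (\<forall>j\<in>{1..<m}. \<forall>z\<in>cball 0 R. norm ((T ^^ N) (\<lambda>z. f N z ^ j) z) < \<epsilon>) \<and>
     (\<forall>z\<in>cball 0 R. norm ((T ^^ N) (\<lambda>z. f N z ^ m) z - (\<Sum>s\<in>B. v s * exp (of_nat m * s * z))) < \<epsilon>)"
    using eventually_happens'[OF sequentially_bot] by blast
  moreover have "f N \<in> entire_functions"
    unfolding f_def entire_functions_def by (auto intro!: holomorphic_intros)
  ultimately show ?thesis by (intro exI[of _ N] bexI[of _ "f N"]) auto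
qed

end

section \<open>Directions of strict logarithmic convexity\<close>

text \<open>
  Taylor's formula of order two.
\<close>
lemma above_tangent_strict:
  fixes f f' f'' :: "real \<Rightarrow> real"
  assumes "\<And>t. t \<in> {a..<b} \<Longrightarrow> (f has_real_derivative f' t) (at t)"
    and "\<And>t. t \<in> {a..<b} \<Longrightarrow> (f' has_real_derivative f'' t) (at t)"
    and pos: "\<And>t. t \<in> {a..<b} \<Longrightarrow> f'' t > 0"
    and st: "s \<in> {a..<b}" "t \<in> {a..<b}" "s \<noteq> t"
  shows "f t > f s + f' s * (t - s)"
proof -
  define df where "df k = (if k = 0 then f else if k = 1 then f' else f'')" for k :: nat
  have "\<exists>\<xi>. (if t < s then t < \<xi> \<and> \<xi> < s else s < \<xi> \<and> \<xi> < t) \<and>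
      f t = (\<Sum>k<2. df k s / fact k * (t - s) ^ k) + df 2 \<xi> / fact 2 * (t - s) ^ 2"
  proof (rule Taylor[where a = "min s t" and b = "max s t"])
    show "\<forall>m x. m < 2 \<and> min s t \<le> x \<and> x \<le> max s t \<longrightarrow>
        (df m has_real_derivative df (Suc m) x) (at x)"
    proof (intro allI impI)
      fix m :: nat and x
      assume mx: "m < 2 \<and> min s t \<le> x \<and> x \<le> max s t"
      then have "x \<in> {a..<b}" using st by auto
      moreover have "m = 0 \<or> m = 1" using mx by auto
      ultimately show "(df m has_real_derivative df (Suc m) x) (at x)"
        using assms(1,2) by (auto simp: df_def)
    qed
  qed (use st in \<open>auto simp: df_def\<close>)
  then obtain \<xi> where \<xi>: "if t < s then t < \<xi> \<and> \<xi> < s else s < \<xi> \<and> \<xi> < t"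
    and eq: "f t = f s + f' s * (t - s) + f'' \<xi> / 2 * (t - s) ^ 2"
    by (auto simp: df_def numeral_2_eq_2)
  have "\<xi> \<in> {a..<b}" using \<xi> st by (auto split: if_splits)
  then have "f'' \<xi> / 2 * (t - s) ^ 2 > 0" using pos st by simp
  then show ?thesis using eq by simp
qed

text \<open>
  Add up the strict tangent inequalities at the mean: the linear terms cancel, and at least one of two
  different arguments is not the mean.
\<close>
lemma strict_Jensen_mean:
  fixes f f' f'' :: "real \<Rightarrow> real"
  assumes deriv: "\<And>t. t \<in> {a..<b} \<Longrightarrow> (f has_real_derivative f' t) (at t)"
      "\<And>t. t \<in> {a..<b} \<Longrightarrow> (f' has_real_derivative f'' t) (at t)"
    and pos: "\<And>t. t \<in> {a..<b} \<Longrightarrow> f'' t > 0"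
    and t: "\<And>i. i < m \<Longrightarrow> t i \<in> {a..<b}"
    and ij: "i < m" "j < m" "t i \<noteq> t j"
  shows "real m * f ((\<Sum>i<m. t i) / real m) < (\<Sum>i<m. f (t i))"
proof -
  have m: "m > 0" using ij by simp
  define s where "s = (\<Sum>i<m. t i) / real m"
  have s: "s \<in> {a..<b}"
  proof -
    have "real m * a \<le> (\<Sum>i<m. t i)"
      using sum_mono[of "{..<m}" "\<lambda>_. a" t] t by simp
    moreover have "(\<Sum>i<m. t i) < real m * b"
      using sum_strict_mono[of "{..<m}" t "\<lambda>_. b"] t m by (auto simp: lessThan_empty_iff)
    ultimately show ?thesis using m by (simp add: s_def field_simps)
  qed
  have strict: "f s + f' s * (t k - s) < f (t k)" if "k < m" "t k \<noteq> s" for k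
    using above_tangent_strict[OF deriv pos s t[OF that(1)]] that(2) by metis
  have "f s + f' s * (t k - s) \<le> f (t k)" if "k < m" for k
    using strict[OF that] by (cases "t k = s") auto
  moreover have "\<exists>k<m. f s + f' s * (t k - s) < f (t k)"
    using strict[OF ij(1)] strict[OF ij(2)] ij by (cases "t i = s") auto
  ultimately have "(\<Sum>i<m. f s + f' s * (t i - s)) < (\<Sum>i<m. f (t i))"
    by (intro sum_strict_mono_ex1) auto
  moreover have "(\<Sum>i<m. f s + f' s * (t i - s)) = real m * f s + f' s * ((\<Sum>i<m. t i) - real m * s)"
    by (simp add: sum.distrib sum_distrib_left[symmetric] sum_subtractf)
  moreover have "(\<Sum>i<m. t i) - real m * s = 0" using m by (simp add: s_def)
  ultimately show ?thesis unfolding s_def[symmetric] by simp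
qed

lemma vanishing_second_derivative_affine:
  assumes g: "g holomorphic_on ball w \<delta>" and "\<And>z. z \<in> ball w \<delta> \<Longrightarrow> deriv (deriv g) z = 0"
  obtains \<alpha> \<beta> where "\<And>z. z \<in> ball w \<delta> \<Longrightarrow> g z = \<alpha> + \<beta> * z"
proof -
  have "\<exists>\<beta>. \<forall>z\<in>ball w \<delta>. deriv g z = \<beta>"
  proof (rule has_field_derivative_zero_constant[OF convex_ball])
    fix z assume z: "z \<in> ball w \<delta>"
    have "(deriv g has_field_derivative deriv (deriv g) z) (at z within ball w \<delta>)"
      by (rule has_field_derivative_at_within[OF
            holomorphic_derivI[OF holomorphic_deriv[OF g open_ball] open_ball z]])
    then show "(deriv g has_field_derivative 0) (at z within ball w \<delta>)" using assms(2)[OF z] by simp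
  qed
  then obtain \<beta> where \<beta>: "\<And>z. z \<in> ball w \<delta> \<Longrightarrow> deriv g z = \<beta>" by blast
  have "\<exists>\<alpha>. \<forall>z\<in>ball w \<delta>. g z - \<beta> * z = \<alpha>"
  proof (rule has_field_derivative_zero_constant[OF convex_ball])
    fix z assume z: "z \<in> ball w \<delta>"
    have "(g has_field_derivative \<beta>) (at z within ball w \<delta>)"
      using has_field_derivative_at_within[OF holomorphic_derivI[OF g open_ball z]] \<beta>[OF z] by simp
    then show "((\<lambda>z. g z - \<beta> * z) has_field_derivative 0) (at z within ball w \<delta>)"
      by (auto intro!: derivative_eq_intros)
  qed
  then obtain \<alpha> where "\<And>z. z \<in> ball w \<delta> \<Longrightarrow> g z - \<beta> * z = \<alpha>" by blast
  then have "\<And>z. z \<in> ball w \<delta> \<Longrightarrow> g z = \<alpha> + \<beta> * z" by (simp add: algebra_simps)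
  then show ?thesis by (rule that)
qed

text \<open>
  On the disc $\Phi = e^g$, and $\log|\Phi| = \mathrm{Re}\, g$ has second derivative
  $\mathrm{Re}(g'' d^2)$ in the direction $d$. Unless $g''$ vanishes identically, which by analytic
  continuation is excluded by \<open>not_exp\<close>, this can be made positive near some point
  by taking $d^2 = \overline{g''}$ there. The conclusion is Jensen's inequality in
  multiplicative form.
\<close>
lemma log_norm_strictly_convex_direction:
  assumes hol: "\<Phi> holomorphic_on UNIV" and \<delta>: "0 < \<delta>"
    and nz: "\<And>z. z \<in> ball w \<delta> \<Longrightarrow> \<Phi> z \<noteq> 0"
    and not_exp: "\<And>\<alpha> \<beta>. \<exists>z. \<Phi> z \<noteq> exp (\<alpha> + \<beta> * z)"
  obtains w' d \<eta> where "d \<noteq> 0" "0 < \<eta>" "\<And>t. t \<in> {0..<\<eta>} \<Longrightarrow> w' + of_real t * d \<in> ball w \<delta>"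
    "\<forall>m t. (\<forall>i<m. t i \<in> {0..<\<eta>}) \<and> (\<exists>i<m. \<exists>j<m. t i \<noteq> t j) \<longrightarrow>
       norm (\<Phi> (w' + of_real ((\<Sum>i<m. t i) / real m) * d)) ^ m < (\<Prod>i<m. norm (\<Phi> (w' + of_real (t i) * d)))"
proof -
  have holB: "\<Phi> holomorphic_on ball w \<delta>" using hol by (rule holomorphic_on_subset) auto
  have "simply_connected (ball w \<delta>)" by (intro convex_imp_simply_connected convex_ball)
  then obtain g where g: "g holomorphic_on ball w \<delta>" "\<And>z. z \<in> ball w \<delta> \<Longrightarrow> \<Phi> z = exp (g z)"
    using holB nz unfolding simply_connected_eq_holomorphic_log[OF open_ball] by metis
  have g1: "deriv g holomorphic_on ball w \<delta>" and g2: "deriv (deriv g) holomorphic_on ball w \<delta>"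
    by (intro holomorphic_deriv g open_ball)+
  have "\<exists>w'\<in>ball w \<delta>. deriv (deriv g) w' \<noteq> 0"
  proof (rule ccontr)
    assume "\<not> ?thesis"
    then obtain \<alpha> \<beta> where \<alpha>\<beta>: "\<And>z. z \<in> ball w \<delta> \<Longrightarrow> g z = \<alpha> + \<beta> * z"
      using vanishing_second_derivative_affine[OF g(1)] by metis
    have "\<Phi> z - exp (\<alpha> + \<beta> * z) = 0" for z
    proof (rule analytic_continuation[of "\<lambda>z. \<Phi> z - exp (\<alpha> + \<beta> * z)" UNIV "ball w \<delta>" w])
      show "(\<lambda>z. \<Phi> z - exp (\<alpha> + \<beta> * z)) holomorphic_on UNIV" by (intro holomorphic_intros hol)
      show "w islimpt ball w \<delta>" using \<delta> by (intro interior_limit_point) auto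
    qed (use g \<alpha>\<beta> in auto)
    then show False using not_exp[of \<alpha> \<beta>] by simp
  qed
  then obtain w' where w': "w' \<in> ball w \<delta>" "deriv (deriv g) w' \<noteq> 0" by blast
  \<comment> \<open>With this choice the second derivative of \<open>Re g\<close> in the direction
    \<open>d\<close> at \<open>w'\<close> is $|g''(w')|^2$.\<close>
  define d where "d = csqrt (cnj (deriv (deriv g) w'))"
  have d: "d \<noteq> 0" using w' by (simp add: d_def)
  have "deriv (deriv g) w' * d\<^sup>2 = of_real ((norm (deriv (deriv g) w'))\<^sup>2)"
    using complex_norm_square[of "deriv (deriv g) w'"] by (simp add: d_def)
  then have "Re (deriv (deriv g) w' * d\<^sup>2) > 0" using w' by simp
  moreover have "continuous_on (ball w \<delta>) (\<lambda>z. Re (deriv (deriv g) z * d\<^sup>2))"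
    by (intro continuous_intros holomorphic_on_imp_continuous_on g2)
  ultimately have "open (ball w \<delta> \<inter> (\<lambda>z. Re (deriv (deriv g) z * d\<^sup>2)) -` {0<..})"
      "w' \<in> ball w \<delta> \<inter> (\<lambda>z. Re (deriv (deriv g) z * d\<^sup>2)) -` {0<..}"
    using w' by (auto intro!: continuous_open_preimage)
  then obtain e where e: "e > 0" "ball w' e \<subseteq> ball w \<delta> \<inter> (\<lambda>z. Re (deriv (deriv g) z * d\<^sup>2)) -` {0<..}"
    using open_contains_ball by metis
  define \<eta> where "\<eta> = e / norm d"
  have \<eta>: "\<eta> > 0" using e d by (simp add: \<eta>_def)
  define \<gamma> where "\<gamma> t = w' + of_real t * d" for t :: real
  have "\<gamma> t \<in> ball w' e" if "t \<in> {0..<\<eta>}" for t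
    using that d by (simp add: \<gamma>_def dist_norm norm_mult \<eta>_def field_simps)
  then have \<gamma>: "\<gamma> t \<in> ball w \<delta>" "Re (deriv (deriv g) (\<gamma> t) * d\<^sup>2) > 0" if "t \<in> {0..<\<eta>}" for t
    using that e(2) by blast+
  have chain: "((\<lambda>t. Re (h (\<gamma> t) * c)) has_real_derivative Re (deriv h (\<gamma> t) * (d * c))) (at t)"
    if "h holomorphic_on ball w \<delta>" "t \<in> {0..<\<eta>}" for h c t
  proof -
    have "(h has_field_derivative deriv h (\<gamma> t)) (at (\<gamma> t))"
      by (rule holomorphic_derivI[OF that(1) open_ball \<gamma>(1)[OF that(2)]])
    moreover have "(\<gamma> has_vector_derivative d) (at t)"
      unfolding \<gamma>_def by (auto intro!: derivative_eq_intros simp: has_vector_derivative_def scaleR_conv_of_real)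
    ultimately have "((h \<circ> \<gamma>) has_vector_derivative (d * deriv h (\<gamma> t))) (at t)"
      by (rule field_vector_diff_chain_at[rotated])
    then have "((\<lambda>t. h (\<gamma> t) * c) has_vector_derivative (d * deriv h (\<gamma> t)) * c) (at t)"
      by (intro has_vector_derivative_mult_left) (simp add: o_def)
    then have "((\<lambda>t. Re (h (\<gamma> t) * c)) has_vector_derivative Re (d * deriv h (\<gamma> t) * c)) (at t)"
      by (rule bounded_linear.has_vector_derivative[OF bounded_linear_Re])
    then show ?thesis by (simp add: has_real_derivative_iff_has_vector_derivative mult_ac)
  qed
  show ?thesis
  proof (rule that[OF d \<eta>])
    show "w' + of_real t * d \<in> ball w \<delta>" if "t \<in> {0..<\<eta>}" for t
      using \<gamma>(1)[OF that] by (simp add: \<gamma>_def)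
  next
    show "\<forall>m t. (\<forall>i<m. t i \<in> {0..<\<eta>}) \<and> (\<exists>i<m. \<exists>j<m. t i \<noteq> t j) \<longrightarrow>
       norm (\<Phi> (w' + of_real ((\<Sum>i<m. t i) / real m) * d)) ^ m < (\<Prod>i<m. norm (\<Phi> (w' + of_real (t i) * d)))"
    proof (intro allI impI, elim conjE exE)
      fix t :: "nat \<Rightarrow> real" and m i j :: nat
      assume t: "\<forall>i<m. t i \<in> {0..<\<eta>}" and ij: "i < m" "j < m" "t i \<noteq> t j"
      define s where "s = (\<Sum>i<m. t i) / real m"
      have mpos: "m > 0" using ij by simp
      have "real m * Re (g (\<gamma> s) * 1) < (\<Sum>i<m. Re (g (\<gamma> (t i)) * 1))"
        unfolding s_def
      proof (rule strict_Jensen_mean[where a = 0 and b = \<eta> and i = i and j = j])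
        fix u assume u: "u \<in> {0..<\<eta>}"
        show "((\<lambda>t. Re (g (\<gamma> t) * 1)) has_real_derivative Re (deriv g (\<gamma> u) * (d * 1))) (at u)"
          by (rule chain[OF g(1) u])
        show "((\<lambda>t. Re (deriv g (\<gamma> t) * (d * 1))) has_real_derivative
            Re (deriv (deriv g) (\<gamma> u) * (d * (d * 1)))) (at u)"
          by (rule chain[OF g1 u])
        show "0 < Re (deriv (deriv g) (\<gamma> u) * (d * (d * 1)))"
          using \<gamma>(2)[OF u] by (simp add: power2_eq_square)
      qed (use t ij in auto)
      then have "exp (real m * Re (g (\<gamma> s))) < exp (\<Sum>i<m. Re (g (\<gamma> (t i))))" by simp
      moreover have "s \<in> {0..<\<eta>}"
      proof -
        have "0 \<le> (\<Sum>i<m. t i)" using t by (intro sum_nonneg) auto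
        moreover have "(\<Sum>i<m. t i) < real m * \<eta>"
          using sum_strict_mono[of "{..<m}" t "\<lambda>_. \<eta>"] t mpos by (auto simp: lessThan_empty_iff)
        ultimately show ?thesis using mpos by (simp add: s_def field_simps)
      qed
      moreover have "norm (\<Phi> (\<gamma> u)) = exp (Re (g (\<gamma> u)))" if "u \<in> {0..<\<eta>}" for u
        using g(2)[OF \<gamma>(1)[OF that]] by (simp add: norm_exp_eq_Re)
      ultimately have "norm (\<Phi> (\<gamma> s)) ^ m < (\<Prod>i<m. norm (\<Phi> (\<gamma> (t i))))"
        using t by (simp add: exp_of_nat_mult exp_sum)
      then show "norm (\<Phi> (w' + of_real ((\<Sum>i<m. t i) / real m) * d)) ^ m
          < (\<Prod>i<m. norm (\<Phi> (w' + of_real (t i) * d)))"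
        by (simp add: \<gamma>_def s_def)
    qed
  qed
qed

section \<open>The first point of maximal exponential growth on a ray\<close>

text \<open>
  The quotient $\log F(r)/r$ is below $0$ on $(0, r_0]$, equals $c > 0$ at $r_1$, and is below $c$ for
  large $r$. Hence its supremum is attained, and only on a compact set of points; \<open>R\<close> is the
  least of them and \<open>M\<close> is the maximum. The proof works with
  $F(r)^{1/r}$, which is also defined and continuous where $F$ vanishes.
\<close>
lemma first_point_of_maximal_growth:
  fixes F :: "real \<Rightarrow> real"
  assumes cont: "continuous_on {0<..} F" and nonneg: "\<And>r. 0 \<le> F r"
    and r0: "0 < r0" "\<And>r. 0 < r \<Longrightarrow> r \<le> r0 \<Longrightarrow> F r < 1"
    and r1: "0 < r1" "F r1 = exp (c * r1)" and c: "0 < c"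
    and ev: "\<forall>\<^sub>F r in at_top. F r < exp (c * r)"
  obtains R M where "0 < R" "0 < M" "F R = exp (M * R)" "\<And>r. 0 < r \<Longrightarrow> F r \<le> exp (M * r)"
    "\<And>r. 0 < r \<Longrightarrow> r < R \<Longrightarrow> F r < exp (M * r)"
proof -
  define q where "q r = F r powr (1 / r)" for r
  have Fq: "F r = q r powr r" if "0 < r" for r
    using that nonneg[of r] by (simp add: q_def powr_powr)
  have q_lt: "q r < exp a" if "0 < r" "F r < exp (a * r)" for r a
  proof -
    have "q r < exp (a * r) powr (1 / r)"
      unfolding q_def using that nonneg[of r] by (intro powr_less_mono2) auto
    then show ?thesis using that by (simp add: powr_def)
  qed
  have "q r1 = exp c" using r1 by (simp add: q_def powr_def)
  have "1 < F r1" using r1 c by simp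
  then have "r0 < r1" using r0(2)[of r1] r1(1) by (cases "r1 \<le> r0") auto
  obtain R0 where R0: "\<And>r. R0 \<le> r \<Longrightarrow> F r < exp (c * r)"
    using ev unfolding eventually_at_top_linorder by blast
  define I where "I = {r0..max R0 r1}"
  have r1I: "r1 \<in> I" using \<open>r0 < r1\<close> by (simp add: I_def)
  have contq: "continuous_on I q"
    unfolding q_def using r0(1) nonneg
    by (intro continuous_on_powr' continuous_intros continuous_on_subset[OF cont]) (auto simp: I_def)
  obtain s where s: "s \<in> I" "\<And>r. r \<in> I \<Longrightarrow> q r \<le> q s"
    using continuous_attains_sup[OF _ _ contq] r1I compact_Icc unfolding I_def by blast
  \<comment> \<open>Outside \<open>I\<close> the function \<open>q\<close> stays below its maximum, so all maximum
    points lie in the compact set \<open>P\<close>.\<close>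
  define P where "P = I \<inter> q -` {q s}"
  have "closed P" unfolding P_def
    by (intro continuous_closed_preimage contq) (auto simp: I_def)
  then have "compact (I \<inter> P)" unfolding I_def by (intro compact_Int_closed) auto
  moreover have "I \<inter> P = P" by (auto simp: P_def)
  ultimately have "compact P" by simp
  have "P \<noteq> {}" using s by (auto simp: P_def)
  obtain R where R: "R \<in> P" "\<And>r. r \<in> P \<Longrightarrow> R \<le> r"
    using compact_attains_inf[OF \<open>compact P\<close> \<open>P \<noteq> {}\<close>] by blast
  have qR: "q R = q s" "R \<in> I" "R > 0" using R r0 by (auto simp: P_def I_def)
  have qc: "exp c \<le> q R" using s(2)[OF r1I] \<open>q r1 = exp c\<close> qR by simp
  have inside: "q r \<le> q R" "r < R \<longrightarrow> q r < q R" if "r \<in> I" for r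
  proof -
    show "q r \<le> q R" using s(2)[OF that] qR by simp
    then show "r < R \<longrightarrow> q r < q R" using R(2)[of r] that qR(1) by (fastforce simp: P_def)
  qed
  have outside: "q r < q R" if "0 < r" "r \<notin> I" for r
  proof (cases "r < r0")
    case True
    then have "q r < exp 0" using r0(2)[of r] that by (intro q_lt) auto
    also have "exp 0 < exp c" using c by simp
    finally show ?thesis using qc by linarith
  next
    case False
    then have "R0 \<le> r" using that by (simp add: I_def)
    then have "q r < exp c" using R0 that by (intro q_lt) auto
    then show ?thesis using qc by linarith
  qed
  define M where "M = ln (q R)"
  have qpos: "q R > 0" using qc exp_gt_zero[of c] by linarith
  have qM: "q R powr r = exp (M * r)" for r using qpos by (simp add: powr_def M_def)
  show ?thesis
  proof (rule that[OF qR(3)])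
    have "c \<le> M" unfolding M_def using qc qpos by (simp add: ln_ge_iff)
    then show "0 < M" using c by linarith
    show "F R = exp (M * R)" using Fq[OF qR(3)] qM by simp
    fix r :: real assume r: "0 < r"
    have "q r \<le> q R" using inside(1) outside r by fastforce
    then show "F r \<le> exp (M * r)"
      unfolding Fq[OF r] qM[symmetric] using r by (intro powr_mono2) (auto simp: q_def)
    assume "r < R"
    then have "q r < q R" using inside(2) outside r by blast
    then show "F r < exp (M * r)"
      unfolding Fq[OF r] qM[symmetric] using r by (intro powr_less_mono2) (auto simp: q_def)
  qed
qed

lemma radial_growth_eventually_less:
  assumes "radial_growth \<Phi> w < ereal c"
  shows "\<forall>\<^sub>F r in at_top. norm (\<Phi> (of_real r * (w / of_real (norm w)))) < exp (c * r)"
proof -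
  have "\<forall>\<^sub>F r in at_top. log_modulus (\<Phi> (of_real r * (w / of_real (norm w)))) / ereal r < ereal c"
    using assms unfolding radial_growth_def by (rule Limsup_lessD)
  then show ?thesis using eventually_gt_at_top[of 0]
  proof eventually_elim
    case (elim r)
    let ?x = "\<Phi> (of_real r * (w / of_real (norm w)))"
    show ?case
    proof (cases "?x = 0")
      case False
      then have "ln (norm ?x) / r < c" using elim by (simp add: log_modulus_def)
      then have "ln (norm ?x) < c * r" using elim by (simp add: field_simps)
      then show ?thesis using False using exp_less_mono[of "ln (norm ?x)"] by fastforce
    qed simp
  qed
qed

text \<open>
  The hypothesis on $\Phi(w)$ is turned into a real bound for the growth. It excludes the value
  $\infty$, and $-\infty$ satisfies any bound.
\<close>
lemma radial_growth_less:
  assumes "w \<noteq> 0" "ereal x > max 1 (exp_ereal (radial_growth \<Phi> w * ereal (norm w)))"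
  shows "radial_growth \<Phi> w < ereal (ln x / norm w)" "x > 1"
proof -
  show x: "x > 1" using assms(2) by (simp add: one_ereal_def)
  show "radial_growth \<Phi> w < ereal (ln x / norm w)"
  proof (cases "radial_growth \<Phi> w")
    case (real \<tau>)
    then have "exp (\<tau> * norm w) < x" using assms(2) by (simp add: exp_ereal_def)
    then have "ln (exp (\<tau> * norm w)) < ln x" using x by (subst ln_less_cancel_iff) auto
    then have "\<tau> * norm w < ln x" by simp
    then show ?thesis using assms(1) real by (simp add: field_simps)
  next
    case PInf
    then show ?thesis using assms by (simp add: exp_ereal_def)
  qed simp
qed

section \<open>From powers to algebras\<close>

context entire_operator
begin

text \<open>
  The Baire argument needs one ball around \<open>f\<close> that serves all exponents up to \<open>m\<close>.
\<close>
lemma powers_continuous: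
  assumes f: "f \<in> entire_functions" and \<epsilon>: "0 < \<epsilon>"
  shows "\<exists>R' \<delta>. 0 < \<delta> \<and> (\<forall>g\<in>entire_ball f R' \<delta>. \<forall>j\<le>m. \<forall>z\<in>cball 0 R.
           norm (T (\<lambda>z. g z ^ j) z - T (\<lambda>z. f z ^ j) z) \<le> \<epsilon>)"
proof (induction m)
  case 0
  show ?case using power_continuous[OF f \<epsilon>, of R 0] by simp
next
  case (Suc m)
  then obtain R1 \<delta>1 where 1: "0 < \<delta>1" "\<forall>g\<in>entire_ball f R1 \<delta>1. \<forall>j\<le>m. \<forall>z\<in>cball 0 R.
      norm (T (\<lambda>z. g z ^ j) z - T (\<lambda>z. f z ^ j) z) \<le> \<epsilon>" by blast
  obtain R2 \<delta>2 where 2: "0 < \<delta>2" "\<forall>g\<in>entire_ball f R2 \<delta>2. \<forall>z\<in>cball 0 R.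
      norm (T (\<lambda>z. g z ^ Suc m) z - T (\<lambda>z. f z ^ Suc m) z) \<le> \<epsilon>"
    using power_continuous[OF f \<epsilon>] by blast
  have sub: "entire_ball f (max R1 R2) (min \<delta>1 \<delta>2) \<subseteq> entire_ball f R1 \<delta>1"
      "entire_ball f (max R1 R2) (min \<delta>1 \<delta>2) \<subseteq> entire_ball f R2 \<delta>2"
    by (intro entire_ball_mono; simp)+
  show ?case
  proof (intro exI conjI ballI allI impI)
    show "0 < min \<delta>1 \<delta>2" using 1 2 by simp
    fix g j and z :: complex assume g: "g \<in> entire_ball f (max R1 R2) (min \<delta>1 \<delta>2)" and j: "j \<le> Suc m"
      and z: "z \<in> cball 0 R"
    have g12: "g \<in> entire_ball f R1 \<delta>1" "g \<in> entire_ball f R2 \<delta>2" using g sub by blast+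
    show "norm (T (\<lambda>z. g z ^ j) z - T (\<lambda>z. f z ^ j) z) \<le> \<epsilon>"
    proof (cases "j = Suc m")
      case True
      then show ?thesis using bspec[OF bspec[OF 2(2) g12(2)] z] by simp
    next
      case False
      then show ?thesis using bspec[OF 1(2) g12(1)] j z by simp
    qed
  qed
qed

text \<open>
  For fixed \<open>m\<close>, fixed precision and a fixed target the functions \<open>f\<close> with the
  required \<open>N\<close> contain a dense open set; countably many targets and precisions
  suffice.
\<close>
lemma generic_powers:
  assumes trans: "\<And>g h R \<epsilon> m. g \<in> entire_functions \<Longrightarrow> h \<in> entire_functions \<Longrightarrow> 0 < \<epsilon> \<Longrightarrow> 1 \<le> m \<Longrightarrow>
    \<exists>N. \<exists>f\<in>entire_functions. \<forall>z\<in>cball 0 R. norm (f z - g z) < \<epsilon> \<and>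
      (\<forall>j\<in>{1..<m}. norm ((T ^^ N) (\<lambda>z. f z ^ j) z) < \<epsilon>) \<and>
      norm ((T ^^ N) (\<lambda>z. f z ^ m) z - h z) < \<epsilon>"
  obtains f where "f \<in> entire_functions"
    "\<And>h R \<epsilon> m. h \<in> entire_functions \<Longrightarrow> 0 < \<epsilon> \<Longrightarrow> 1 \<le> m \<Longrightarrow>
      \<exists>N. \<forall>z\<in>cball 0 R. (\<forall>j\<in>{1..<m}. norm ((T ^^ N) (\<lambda>z. f z ^ j) z) \<le> \<epsilon>) \<and>
        norm ((T ^^ N) (\<lambda>z. f z ^ m) z - h z) \<le> \<epsilon>"
proof -
  obtain Q where Q: "countable Q" "Q \<subseteq> entire_functions"
    "\<And>g R \<epsilon>. g \<in> entire_functions \<Longrightarrow> 0 < \<epsilon> \<Longrightarrow> \<exists>q\<in>Q. \<forall>z\<in>cball 0 R. norm (q z - g z) < \<epsilon>"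
    by (rule countable_dense_entire_functions, rule that)
  define G where "G m k q = {f \<in> entire_functions. \<exists>N. \<forall>z\<in>cball 0 (real k).
      (\<forall>j\<in>{1..<m}. norm ((T ^^ N) (\<lambda>z. f z ^ j) z) \<le> 1 / (real k + 1)) \<and>
      norm ((T ^^ N) (\<lambda>z. f z ^ m) z - q z) \<le> 1 / (real k + 1)}" for m k :: nat and q
  define \<G> where "\<G> = (\<lambda>(m, k, q). G m k q) ` ({1..} \<times> UNIV \<times> Q)"
  have "\<exists>f\<in>entire_functions. \<forall>H\<in>\<G>. f \<in> H"
  proof (rule entire_Baire)
    show "countable \<G>" unfolding \<G>_def using Q(1) by (intro countable_image countable_SIGMA) auto
    fix H f R and \<delta> :: real
    assume H: "H \<in> \<G>" and f: "f \<in> entire_functions" and \<delta>: "0 < \<delta>"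
    then obtain m k q where mkq: "H = G m k q" "1 \<le> m" "q \<in> Q" unfolding \<G>_def by auto
    define \<epsilon> where "\<epsilon> = 1 / (2 * (real k + 1))"
    have \<epsilon>: "0 < \<epsilon>" "\<epsilon> + \<epsilon> = 1 / (real k + 1)" by (auto simp: \<epsilon>_def field_simps)
    have "0 < min \<delta> \<epsilon>" "q \<in> entire_functions" using \<delta> \<epsilon> mkq Q(2) by auto
    from trans[OF f this(2,1) mkq(2), of "max R (real k)"] obtain N g where g: "g \<in> entire_functions"
      "\<And>z. z \<in> cball 0 (max R (real k)) \<Longrightarrow> norm (g z - f z) < min \<delta> \<epsilon> \<and>
        (\<forall>j\<in>{1..<m}. norm ((T ^^ N) (\<lambda>z. g z ^ j) z) < min \<delta> \<epsilon>) \<and>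
        norm ((T ^^ N) (\<lambda>z. g z ^ m) z - q z) < min \<delta> \<epsilon>" by blast
    interpret N: entire_operator "T ^^ N" by (rule iterate)
    obtain R' \<delta>' where R': "0 < \<delta>'" and stable: "\<And>g' j z. g' \<in> entire_ball g R' \<delta>' \<Longrightarrow> j \<le> m \<Longrightarrow>
        z \<in> cball 0 (real k) \<Longrightarrow> norm ((T ^^ N) (\<lambda>z. g' z ^ j) z - (T ^^ N) (\<lambda>z. g z ^ j) z) \<le> \<epsilon>"
      using N.powers_continuous[OF g(1) \<epsilon>(1), of m "real k"] by blast
    have "entire_ball g R' \<delta>' \<subseteq> H"
    proof
      fix g' assume g': "g' \<in> entire_ball g R' \<delta>'"
      have "(\<forall>j\<in>{1..<m}. norm ((T ^^ N) (\<lambda>z. g' z ^ j) z) \<le> 1 / (real k + 1)) \<and>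
          norm ((T ^^ N) (\<lambda>z. g' z ^ m) z - q z) \<le> 1 / (real k + 1)" if z: "z \<in> cball 0 (real k)" for z
      proof -
        have gz: "\<forall>j\<in>{1..<m}. norm ((T ^^ N) (\<lambda>z. g z ^ j) z) < \<epsilon>"
            "norm ((T ^^ N) (\<lambda>z. g z ^ m) z - q z) < \<epsilon>"
          using g(2)[of z] z by auto
        have "norm ((T ^^ N) (\<lambda>z. g' z ^ j) z) \<le> 1 / (real k + 1)" if j: "j \<in> {1..<m}" for j
          using stable[OF g' _ z, of j] bspec[OF gz(1) j] j \<epsilon>(2)
            norm_triangle_sub[of "(T ^^ N) (\<lambda>z. g' z ^ j) z" "(T ^^ N) (\<lambda>z. g z ^ j) z"] by simp
        moreover have "norm ((T ^^ N) (\<lambda>z. g' z ^ m) z - q z) \<le> 1 / (real k + 1)"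
          using stable[OF g' _ z, of m] gz(2) \<epsilon>(2)
            norm_triangle_ineq[of "(T ^^ N) (\<lambda>z. g' z ^ m) z - (T ^^ N) (\<lambda>z. g z ^ m) z"
              "(T ^^ N) (\<lambda>z. g z ^ m) z - q z"] by simp
        ultimately show ?thesis by blast
      qed
      then show "g' \<in> H" using g' unfolding mkq(1) G_def entire_ball_def by blast
    qed
    moreover have "g \<in> entire_ball f R \<delta>"
      using g unfolding entire_ball_def by (auto intro!: less_imp_le)
    ultimately show "\<exists>g\<in>entire_ball f R \<delta>. \<exists>R' \<delta>'. 0 < \<delta>' \<and> entire_ball g R' \<delta>' \<subseteq> H"
      using R' by blast
  qed
  then obtain f where f: "f \<in> entire_functions" and fG: "\<And>H. H \<in> \<G> \<Longrightarrow> f \<in> H" by blast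
  show ?thesis
  proof (rule that[OF f])
    fix h R m and \<epsilon> :: real assume h: "h \<in> entire_functions" and \<epsilon>: "0 < \<epsilon>" and m: "1 \<le> (m::nat)"
    obtain k :: nat where k: "real k \<ge> max R (2 / \<epsilon>)" using real_arch_simple by blast
    obtain q where q: "q \<in> Q" "\<forall>z\<in>cball 0 R. norm (q z - h z) < \<epsilon> / 2"
      using Q(3)[OF h, of "\<epsilon>/2" R] \<epsilon> by auto
    have "f \<in> G m k q" using q m by (intro fG) (auto simp: \<G>_def)
    then obtain N where N: "\<And>z. z \<in> cball 0 (real k) \<Longrightarrow>
      (\<forall>j\<in>{1..<m}. norm ((T ^^ N) (\<lambda>z. f z ^ j) z) \<le> 1 / (real k + 1)) \<and>
      norm ((T ^^ N) (\<lambda>z. f z ^ m) z - q z) \<le> 1 / (real k + 1)"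
      unfolding G_def by blast
    have k2: "1 / (real k + 1) \<le> \<epsilon> / 2" using k \<epsilon> by (simp add: field_simps)
    have "(\<forall>j\<in>{1..<m}. norm ((T ^^ N) (\<lambda>z. f z ^ j) z) \<le> \<epsilon>) \<and>
        norm ((T ^^ N) (\<lambda>z. f z ^ m) z - h z) \<le> \<epsilon>" if z: "z \<in> cball 0 R" for z
    proof -
      have zk: "z \<in> cball 0 (real k)" using z k by simp
      have "norm ((T ^^ N) (\<lambda>z. f z ^ j) z) \<le> \<epsilon>" if "j \<in> {1..<m}" for j
        using N[OF zk] that k2 \<epsilon> by fastforce
      moreover have "norm ((T ^^ N) (\<lambda>z. f z ^ m) z - h z) \<le> \<epsilon>"
        using N[OF zk] bspec[OF q(2) z] k2
          norm_triangle_ineq[of "(T ^^ N) (\<lambda>z. f z ^ m) z - q z" "q z - h z"] by simp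
      ultimately show ?thesis by blast
    qed
    then show "\<exists>N. \<forall>z\<in>cball 0 R. (\<forall>j\<in>{1..<m}. norm ((T ^^ N) (\<lambda>z. f z ^ j) z) \<le> \<epsilon>) \<and>
        norm ((T ^^ N) (\<lambda>z. f z ^ m) z - h z) \<le> \<epsilon>" by blast
  qed
qed

text \<open>
  If \<open>p\<close> has degree \<open>m\<close>, apply the hypothesis to the target \<open>g\<close>
  divided by the leading coefficient. The lower terms of \<open>p\<close> are negligible, and
  there is no constant term.
\<close>
lemma polynomial_orbit_dense:
  assumes f: "f \<in> entire_functions"
    and orbit: "\<And>h R \<epsilon> m. h \<in> entire_functions \<Longrightarrow> 0 < \<epsilon> \<Longrightarrow> 1 \<le> m \<Longrightarrow>
      \<exists>N. \<forall>z\<in>cball 0 R. (\<forall>j\<in>{1..<m}. norm ((T ^^ N) (\<lambda>z. f z ^ j) z) \<le> \<epsilon>) \<and>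
        norm ((T ^^ N) (\<lambda>z. f z ^ m) z - h z) \<le> \<epsilon>"
    and p: "p \<noteq> 0" "poly p 0 = 0" and g: "g \<in> entire_functions" and \<epsilon>: "0 < \<epsilon>"
  shows "\<exists>N. \<forall>z\<in>cball 0 R. norm ((T ^^ N) (\<lambda>z. poly p (f z)) z - g z) \<le> \<epsilon>"
proof -
  define m where "m = degree p"
  have c0: "coeff p 0 = 0" using p(2) by (simp add: poly_0_coeff_0)
  have m: "1 \<le> m"
  proof (rule ccontr)
    assume "\<not> 1 \<le> m"
    then have "degree p = 0" by (simp add: m_def)
    then have "lead_coeff p = 0" using c0 by (simp only:)
    then show False using p(1) by simp
  qed
  have lc: "coeff p m \<noteq> 0" using p(1) by (simp add: m_def)
  define K where "K = (\<Sum>j\<le>m. norm (coeff p j))"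
  have K: "0 < K" unfolding K_def using lc by (intro sum_pos2[of _ m]) auto
  define h where "h z = g z / coeff p m" for z
  have "h \<in> entire_functions"
    using g lc unfolding h_def entire_functions_holomorphic by (intro holomorphic_intros)
  moreover have "0 < \<epsilon> / K" using \<epsilon> K by simp
  ultimately obtain N where N: "\<And>z. z \<in> cball 0 R \<Longrightarrow>
      (\<forall>j\<in>{1..<m}. norm ((T ^^ N) (\<lambda>z. f z ^ j) z) \<le> \<epsilon> / K) \<and>
      norm ((T ^^ N) (\<lambda>z. f z ^ m) z - h z) \<le> \<epsilon> / K"
    using orbit[of h "\<epsilon> / K" m R] m by blast
  interpret N: entire_operator "T ^^ N" by (rule iterate)
  have pow: "(\<lambda>z. f z ^ j) \<in> entire_functions" for j
    using f unfolding entire_functions_holomorphic by (intro holomorphic_intros)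
  have poly: "(\<lambda>z. poly p (f z)) = (\<lambda>z. \<Sum>j\<in>{..m}. coeff p j * f z ^ j)"
    by (simp add: poly_altdef m_def)
  have image: "(T ^^ N) (\<lambda>z. poly p (f z)) = (\<lambda>z. \<Sum>j\<in>{..m}. coeff p j * (T ^^ N) (\<lambda>z. f z ^ j) z)"
    unfolding poly by (rule N.linear_combination[OF _ pow]) simp
  have "norm ((T ^^ N) (\<lambda>z. poly p (f z)) z - g z) \<le> \<epsilon>" if z: "z \<in> cball 0 R" for z
  proof -
    define D where "D j = (T ^^ N) (\<lambda>z. f z ^ j) z - (if j = m then h z else 0)" for j
    have "(\<Sum>j\<le>m. coeff p j * (if j = m then h z else 0)) = g z"
      using lc by (simp add: h_def if_distrib cong: if_cong)
    then have "(T ^^ N) (\<lambda>z. poly p (f z)) z - g z = (\<Sum>j\<le>m. coeff p j * D j)"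
      by (simp add: image D_def right_diff_distrib sum_subtractf)
    also have "norm \<dots> \<le> (\<Sum>j\<le>m. norm (coeff p j) * (\<epsilon> / K))"
    proof (rule sum_norm_le)
      fix j assume "j \<in> {..m}"
      then consider "j = 0" | "j \<in> {1..<m}" | "j = m" by force
      then show "norm (coeff p j * D j) \<le> norm (coeff p j) * (\<epsilon> / K)"
      proof cases
        case 1
        then show ?thesis by (simp add: c0)
      next
        case 2
        then have "norm (D j) \<le> \<epsilon> / K" using N[OF z] by (simp add: D_def)
        then show ?thesis unfolding norm_mult by (intro mult_left_mono) auto
      next
        case 3
        then have "norm (D j) \<le> \<epsilon> / K" using N[OF z] by (simp add: D_def)
        then show ?thesis unfolding norm_mult by (intro mult_left_mono) auto
      qed
    qed
    also have "\<dots> = K * (\<epsilon> / K)" unfolding K_def by (rule sum_distrib_right[symmetric])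
    also have "\<dots> = \<epsilon>" using K by simp
    finally show ?thesis .
  qed
  then show ?thesis by blast
qed

lemma supports_hypercyclic_algebra_if_powers_transitive:
  assumes trans: "\<And>g h R \<epsilon> m. g \<in> entire_functions \<Longrightarrow> h \<in> entire_functions \<Longrightarrow> 0 < \<epsilon> \<Longrightarrow> 1 \<le> m \<Longrightarrow>
    \<exists>N. \<exists>f\<in>entire_functions. \<forall>z\<in>cball 0 R. norm (f z - g z) < \<epsilon> \<and>
      (\<forall>j\<in>{1..<m}. norm ((T ^^ N) (\<lambda>z. f z ^ j) z) < \<epsilon>) \<and>
      norm ((T ^^ N) (\<lambda>z. f z ^ m) z - h z) < \<epsilon>"
  shows "supports_hypercyclic_algebra T"
proof -
  obtain f where f: "f \<in> entire_functions" and orbit: "\<And>h R \<epsilon> m. h \<in> entire_functions \<Longrightarrow> 0 < \<epsilon> \<Longrightarrow> 1 \<le> m \<Longrightarrow>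
      \<exists>N. \<forall>z\<in>cball 0 R. (\<forall>j\<in>{1..<m}. norm ((T ^^ N) (\<lambda>z. f z ^ j) z) \<le> \<epsilon>) \<and>
        norm ((T ^^ N) (\<lambda>z. f z ^ m) z - h z) \<le> \<epsilon>"
    by (rule generic_powers[OF trans], assumption+, rule that)
  have dense: "\<exists>N. \<forall>z\<in>cball 0 R. norm ((T ^^ N) (\<lambda>z. poly p (f z)) z - g z) \<le> \<epsilon>"
    if "p \<noteq> 0" "poly p 0 = 0" "g \<in> entire_functions" "0 < \<epsilon>" for p g R \<epsilon>
    by (rule polynomial_orbit_dense[OF f _ that]) (rule orbit)
  define A where "A = {(\<lambda>z. poly p (f z)) | p. poly p 0 = 0}"
  have A_entire: "A \<subseteq> entire_functions"
    using f unfolding A_def entire_functions_def by (auto intro!: holomorphic_intros)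
  have AI: "(\<lambda>z. poly p (f z)) \<in> A" if "poly p 0 = 0" for p using that by (auto simp: A_def)
  have "entire_subalgebra A"
    unfolding entire_subalgebra_def
  proof (intro conjI ballI allI A_entire)
    show "(\<lambda>z. 0) \<in> A" using AI[of 0] by simp
  next
    fix a b assume "a \<in> A" "b \<in> A"
    then obtain p q where "a = (\<lambda>z. poly p (f z))" "poly p 0 = 0" "b = (\<lambda>z. poly q (f z))" "poly q 0 = 0"
      by (auto simp: A_def)
    then show "(\<lambda>z. a z + b z) \<in> A" "(\<lambda>z. a z * b z) \<in> A"
      using AI[of "p + q"] AI[of "p * q"] by simp_all
  next
    fix c a assume "a \<in> A"
    then obtain p where "a = (\<lambda>z. poly p (f z))" "poly p 0 = 0" by (auto simp: A_def)
    then show "(\<lambda>z. c * a z) \<in> A" using AI[of "smult c p"] by simp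
  qed
  moreover have "A \<noteq> {\<lambda>z. 0}"
  proof
    assume "A = {\<lambda>z. 0}"
    then have "f = (\<lambda>z. 0)" using AI[of "[:0, 1:]"] by auto
    moreover have "(\<lambda>z. 1) \<in> entire_functions" by (simp add: entire_functions_def)
    moreover obtain N where "\<forall>z\<in>cball 0 0. norm ((T ^^ N) (\<lambda>z. poly [:0, 1:] (f z)) z - 1) \<le> 1 / 2"
      using dense[of "[:0, 1:]" "\<lambda>z. 1" "1/2" 0] by (auto simp: entire_functions_def)
    moreover have "(T ^^ N) (\<lambda>z. 0) = (\<lambda>z. 0)"
      by (rule entire_operator.zero[OF iterate])
    ultimately show False by simp
  qed
  moreover have "hypercyclic_vector entire_topology T a" if a: "a \<in> A" "a \<noteq> (\<lambda>z. 0)" for a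
  proof -
    obtain p where p: "a = (\<lambda>z. poly p (f z))" "poly p 0 = 0" using a by (auto simp: A_def)
    then have "p \<noteq> 0" using a by auto
    show ?thesis
    proof (rule hypercyclic_vectorI)
      show "a \<in> entire_functions" using a A_entire by blast
    qed (use dense[OF \<open>p \<noteq> 0\<close> p(2)] entire p(1) in auto)
  qed
  ultimately show ?thesis unfolding supports_hypercyclic_algebra_def by blast
qed

end

section \<open>Separating the growth of words\<close>

text \<open>
  The point $w = Ru$ comes from \<open>first_point_of_maximal_growth\<close> applied to
  $|\Phi(ru)|$: since $kR/m < R$, the bound $|\Phi(kw/m)| < e^{MkR/m}$ is strict, and $|\Phi(w)| = e^{MR}$.
\<close>
lemma subordinate_growth:
  assumes hol: "\<Phi> holomorphic_on UNIV" and z0: "z0 \<in> open_segment 0 z1"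
    and small: "\<forall>z \<in> closed_segment 0 z0 - {0}. norm (\<Phi> z) < 1"
    and large: "ereal (norm (\<Phi> z1)) > max 1 (exp_ereal (radial_growth \<Phi> z1 * ereal (norm z1)))"
  obtains w where "norm (\<Phi> w) > 1"
    "\<And>k m. 1 \<le> k \<Longrightarrow> k < m \<Longrightarrow> norm (\<Phi> (of_nat k * w / of_nat m)) ^ m < norm (\<Phi> w) ^ k"
    "\<And>\<alpha> \<beta>. \<exists>z. \<Phi> z \<noteq> exp (\<alpha> + \<beta> * z)"
proof -
  obtain s where s: "0 < s" "s < 1" "z0 = of_real s * z1" and z1: "z1 \<noteq> 0"
    using z0 by (auto simp: in_segment scaleR_conv_of_real)
  define u where "u = z1 / of_real (norm z1)"
  have u: "norm u = 1" "z1 = of_real (norm z1) * u" using z1 by (auto simp: u_def norm_divide)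
  define F where "F r = norm (\<Phi> (of_real r * u))" for r :: real
  define c where "c = ln (norm (\<Phi> z1)) / norm z1"
  have growth: "radial_growth \<Phi> z1 < ereal c" and big: "norm (\<Phi> z1) > 1"
    using radial_growth_less[OF z1 large] by (auto simp: c_def)
  have cont: "continuous_on S \<Phi>" for S
    using continuous_on_subset[OF holomorphic_on_imp_continuous_on[OF hol] subset_UNIV] .
  have contF: "continuous_on {0<..} F"
    unfolding F_def by (intro continuous_intros continuous_on_compose2[OF cont[of UNIV]]) auto
  have F_small: "F r < 1" if r: "0 < r" "r \<le> norm z0" for r
  proof -
    have nz0: "norm z0 = s * norm z1" using s by (simp add: norm_mult)
    have "(r / norm z0) *\<^sub>R z0 = of_real (r / (s * norm z1)) * (of_real s * z1)"
      unfolding nz0 scaleR_conv_of_real by (simp only: s(3))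
    then have "of_real r * u = (r / norm z0) *\<^sub>R z0"
      using s z1 by (simp add: u_def)
    moreover have "0 \<le> r / norm z0" "r / norm z0 \<le> 1" using r by (simp_all add: divide_le_eq_1)
    ultimately have "of_real r * u \<in> closed_segment 0 z0"
      by (auto simp: in_segment intro!: exI[of _ "r / norm z0"])
    moreover have "of_real r * u \<noteq> 0" using r u by auto
    ultimately show ?thesis using small by (simp add: F_def)
  qed
  have F1: "F (norm z1) = exp (c * norm z1)"
  proof -
    have "F (norm z1) = norm (\<Phi> z1)" unfolding F_def u(2)[symmetric] ..
    moreover have "exp (ln (norm (\<Phi> z1))) = norm (\<Phi> z1)" using big by (intro exp_ln) linarith
    ultimately show ?thesis using z1 by (simp add: c_def)
  qed
  have ev: "\<forall>\<^sub>F r in at_top. F r < exp (c * r)"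
    using radial_growth_eventually_less[OF growth] by (simp add: F_def u_def)
  have nz0: "norm z0 > 0" using s z1 by simp
  have nz1: "norm z1 > 0" using z1 by simp
  have c: "c > 0" unfolding c_def by (intro divide_pos_pos ln_gt_zero big nz1)
  have F0: "0 \<le> F r" for r by (simp add: F_def)
  obtain R M where R: "0 < R" and M: "0 < M" and FR: "F R = exp (M * R)"
    and le: "\<And>r. 0 < r \<Longrightarrow> F r \<le> exp (M * r)"
    and less: "\<And>r. 0 < r \<Longrightarrow> r < R \<Longrightarrow> F r < exp (M * r)"
    by (rule first_point_of_maximal_growth[OF contF F0 nz0 F_small nz1 F1 c ev], assumption+, rule that)
  show ?thesis
  proof (rule that[of "of_real R * u"])
    have w: "norm (\<Phi> (of_real R * u)) = exp (M * R)" using FR by (simp add: F_def)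
    show "norm (\<Phi> (of_real R * u)) > 1" unfolding w using R M by simp
    fix k m :: nat assume km: "1 \<le> k" "k < m"
    define r where "r = real k * R / real m"
    have r: "0 < r" "r < R" using km R by (auto simp: r_def field_simps)
    have "of_nat k * (of_real R * u) / of_nat m = of_real r * u" by (simp add: r_def)
    then have "norm (\<Phi> (of_nat k * (of_real R * u) / of_nat m)) ^ m = F r ^ m" by (simp add: F_def)
    also have "\<dots> < exp (M * r) ^ m"
      using less[OF r] km by (intro power_strict_mono) (auto simp: F_def)
    also have "\<dots> = exp (M * R) ^ k"
      using km by (simp add: exp_of_nat_mult[symmetric] r_def)
    finally show "norm (\<Phi> (of_nat k * (of_real R * u) / of_nat m)) ^ m
        < norm (\<Phi> (of_real R * u)) ^ k" unfolding w .
  next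
    fix \<alpha> \<beta>
    show "\<exists>z. \<Phi> z \<noteq> exp (\<alpha> + \<beta> * z)"
    proof (rule ccontr)
      assume "\<not> ?thesis"
      then have "F r = exp (Re \<alpha> + r * Re (\<beta> * u))" for r
        by (simp add: F_def norm_exp_eq_Re algebra_simps)
      then have le': "Re \<alpha> + r * Re (\<beta> * u) \<le> M * r" if "0 < r" for r
        using le[OF that] by simp
      \<comment> \<open>An affine function that agrees with $Mr$ at $R$ and lies strictly below it at $R/2$
        exceeds it at $2R$.\<close>
      have eq: "Re \<alpha> + R * Re (\<beta> * u) = M * R"
        and lt: "Re \<alpha> + R/2 * Re (\<beta> * u) < M * (R/2)"
        using FR less[of "R/2"] R \<open>\<And>r. F r = exp (Re \<alpha> + r * Re (\<beta> * u))\<close> by simp_all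
      have "Re \<alpha> + (2*R) * Re (\<beta> * u) \<le> M * (2*R)" using le' R by simp
      then show False using eq lt by (simp add: algebra_simps)
    qed
  qed
qed

text \<open>
  Any \<open>q\<close> slightly below the $m$-th root of \<open>y\<close> will do.
\<close>
lemma powers_separated:
  fixes x :: "nat \<Rightarrow> real"
  assumes m: "1 \<le> m" and y: "1 < y" and x: "\<And>k. k \<in> {1..<m} \<Longrightarrow> 0 \<le> x k" "\<And>k. k \<in> {1..<m} \<Longrightarrow> x k ^ m < y ^ k"
  obtains q where "1 < q" "q ^ m < y" "\<And>k. k \<in> {1..<m} \<Longrightarrow> x k < q ^ k"
proof -
  define \<theta> where "\<theta> = root m y"
  have \<theta>m: "\<theta> ^ m = y" using m y by (simp add: \<theta>_def)
  have \<theta>: "1 < \<theta>" using m y by (simp add: \<theta>_def)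
  have "x k < \<theta> ^ k" if "k \<in> {1..<m}" for k
  proof -
    have "x k ^ m < (\<theta> ^ k) ^ m" using x(2)[OF that] \<theta>m by (metis mult.commute power_mult)
    then show ?thesis using \<theta> by (intro power_less_imp_less_base[of "x k" m]) auto
  qed
  then have "\<forall>\<^sub>F q in at_left \<theta>. \<forall>k\<in>{1..<m}. x k < q ^ k"
    by (intro eventually_ball_finite ballI order_tendstoD(1)[OF tendsto_power[OF tendsto_ident_at]]) auto
  from eventually_conj[OF this eventually_at_left_real[OF \<theta>]]
  obtain q where q: "\<forall>k\<in>{1..<m}. x k < q ^ k" "1 < q" "q < \<theta>"
    using eventually_happens'[OF trivial_limit_at_left_real] by fastforce
  have "q ^ m < y" unfolding \<theta>m[symmetric] using q m by (intro power_strict_mono) auto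
  then show ?thesis using q by (intro that) auto
qed

text \<open>
  The three cases are distinguished by the number \<open>k\<close> of letters in \<open>B\<close>.
  For $k = 0$ the sum stays on the segment where $|\Phi| < 1$. For $0 < k < m$ the sum is within
  \<open>\<delta>\<close> of $kw/m$, so $|\Phi| < q^k$ there, while each letter in \<open>B\<close>
  contributes a factor $|\sigma| \le 1/q$. For $k = m$ the claim is the strict Jensen inequality.
\<close>
lemma mixed_words_contract:
  fixes \<Phi> \<sigma> :: "complex \<Rightarrow> complex"
  assumes m: "1 \<le> m" and q: "1 < q" and \<delta>: "0 < \<delta>"
    and \<Gamma>: "\<And>s. s \<in> \<Gamma> \<Longrightarrow> \<sigma> s = 1" "\<And>s. s \<in> \<Gamma> \<Longrightarrow> norm s < \<delta> / (2 * real m)"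
      "\<And>s. s \<in> \<Gamma> \<Longrightarrow> \<exists>t. 0 < t \<and> t \<le> 1 / real m \<and> s = of_real t * z0"
    and contr: "\<And>t. 0 < t \<Longrightarrow> t \<le> 1 \<Longrightarrow> norm (\<Phi> (of_real t * z0)) < 1"
    and B: "\<And>s. s \<in> B \<Longrightarrow> \<sigma> s ^ m * \<Phi> (of_nat m * s) = 1"
      "\<And>s. s \<in> B \<Longrightarrow> norm (s - w / of_nat m) < \<delta> / (2 * real m)"
    and near: "\<And>k x. k \<in> {1..<m} \<Longrightarrow> norm x < \<delta> \<Longrightarrow> norm (\<Phi> (of_nat k * w / of_nat m + x)) < q ^ k"
    and above: "\<And>x. norm x < \<delta> \<Longrightarrow> q ^ m < norm (\<Phi> (w + x))"
    and jensen: "\<And>p i j. (\<And>i. i < m \<Longrightarrow> p i \<in> B) \<Longrightarrow> i < m \<Longrightarrow> j < m \<Longrightarrow> p i \<noteq> p j \<Longrightarrow>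
      norm (\<Phi> (\<Sum>i<m. p i)) ^ m < (\<Prod>i<m. norm (\<Phi> (of_nat m * p i)))"
    and j: "1 \<le> j" "j \<le> m" and p: "p \<in> {..<j} \<rightarrow>\<^sub>E (\<Gamma> \<union> B)"
    and nonconst: "\<not> (j = m \<and> (\<exists>s\<in>B. p = (\<lambda>i\<in>{..<m}. s)))"
  shows "norm ((\<Prod>i<j. \<sigma> (p i)) * \<Phi> (\<Sum>i<j. p i)) < 1"
proof -
  have pi: "p i \<in> \<Gamma> \<or> p i \<in> B" if "i < j" for i using p that by auto
  define I where "I = {i \<in> {..<j}. p i \<in> B}"
  define k where "k = card I"
  have "k \<le> card {..<j}" unfolding k_def I_def by (intro card_mono) auto
  then consider "k = 0" | "k \<in> {1..<m}" | "k = m" "j = m" using j by force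
  then show ?thesis
  proof cases
    case 1
    then have "I = {}" by (simp add: k_def I_def)
    then have p\<Gamma>: "p i \<in> \<Gamma>" if "i < j" for i using pi that by (auto simp: I_def)
    then have "\<forall>i\<in>{..<j}. \<exists>t. 0 < t \<and> t \<le> 1 / real m \<and> p i = of_real t * z0" using \<Gamma>(3) by blast
    from bchoice[OF this] obtain t where t: "\<And>i. i < j \<Longrightarrow> 0 < t i \<and> t i \<le> 1 / real m \<and> p i = of_real (t i) * z0"
      by auto
    have "(\<Sum>i<j. t i) \<le> (\<Sum>i<j. 1 / real m)" using t by (intro sum_mono) auto
    also have "\<dots> \<le> 1" using j by simp
    finally have "(\<Sum>i<j. t i) \<le> 1" .
    moreover have "0 < (\<Sum>i<j. t i)" using t j by (intro sum_pos) (auto simp: lessThan_empty_iff)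
    moreover have "(\<Sum>i<j. p i) = of_real (\<Sum>i<j. t i) * z0" using t by (simp add: sum_distrib_right)
    moreover have "(\<Prod>i<j. \<sigma> (p i)) = 1" using p\<Gamma> \<Gamma>(1) by simp
    ultimately show ?thesis using contr[of "\<Sum>i<j. t i"] by (simp del: of_real_sum)
  next
    case 2
    \<comment> \<open>The ideal position of each letter: $w/m$ for letters in \<open>B\<close>, the origin for
      letters in \<open>\<Gamma>\<close>.\<close>
    define b where "b i = (if i \<in> I then w / of_nat m else 0)" for i
    have sum_b: "(\<Sum>i<j. b i) = of_nat k * w / of_nat m"
    proof -
      have "(\<Sum>i<j. b i) = (\<Sum>i\<in>I. w / of_nat m)"
        unfolding b_def I_def by (subst sum.inter_filter[symmetric]) (auto intro!: sum.cong)
      then show ?thesis by (simp add: k_def)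
    qed
    have close: "norm (p i - b i) \<le> \<delta> / (2 * real m)" if "i < j" for i
      using pi[OF that] that \<Gamma>(2) B(2) by (auto simp: b_def I_def intro!: less_imp_le)
    have "norm (\<Sum>i<j. p i - b i) \<le> (\<Sum>i<j. \<delta> / (2 * real m))"
      using close by (intro sum_norm_le) auto
    also have "\<dots> = real j * (\<delta> / (2 * real m))" by simp
    also have "\<dots> \<le> real m * (\<delta> / (2 * real m))"
      using j \<delta> by (intro mult_right_mono) auto
    also have "\<dots> < \<delta>" using m \<delta> by simp
    finally have "norm (\<Phi> (of_nat k * w / of_nat m + (\<Sum>i<j. p i - b i))) < q ^ k"
      by (rule near[OF 2])
    then have \<Phi>_lt: "norm (\<Phi> (\<Sum>i<j. p i)) < q ^ k"
      by (simp add: sum_subtractf sum_b)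
    have \<sigma>_le: "norm (\<sigma> s) \<le> 1 / q" if s: "s \<in> B" for s
    proof -
      have "norm (of_nat m * s - w) = real m * norm (s - w / of_nat m)"
        using m by (subst norm_of_nat[symmetric, where 'a = complex], subst norm_mult[symmetric])
          (simp add: right_diff_distrib)
      also have "\<dots> < real m * (\<delta> / (2 * real m))" using B(2)[OF s] m by (intro mult_strict_left_mono) auto
      also have "\<dots> < \<delta>" using m \<delta> by simp
      finally have big: "q ^ m < norm (\<Phi> (of_nat m * s))"
        using above[of "of_nat m * s - w"] by simp
      have eq: "norm (\<sigma> s) ^ m * norm (\<Phi> (of_nat m * s)) = 1"
        using arg_cong[OF B(1)[OF s], of norm] by (simp add: norm_mult norm_power)
      have "norm (\<sigma> s) ^ m * q ^ m \<le> norm (\<sigma> s) ^ m * norm (\<Phi> (of_nat m * s))"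
        using big by (intro mult_left_mono) auto
      then have "(norm (\<sigma> s) * q) ^ m \<le> 1 ^ m" using eq by (simp add: power_mult_distrib)
      then have "norm (\<sigma> s) * q \<le> 1" using m by (subst (asm) power_mono_iff) (use q in auto)
      then show ?thesis using q by (simp add: field_simps)
    qed
    have "norm (\<Prod>i<j. \<sigma> (p i)) \<le> (\<Prod>i<j. if i \<in> I then 1 / q else 1)"
      unfolding prod_norm[symmetric]
    proof (rule prod_mono)
      fix i assume i: "i \<in> {..<j}"
      show "0 \<le> norm (\<sigma> (p i)) \<and> norm (\<sigma> (p i)) \<le> (if i \<in> I then 1 / q else 1)"
        using pi[of i] i \<sigma>_le[of "p i"] \<Gamma>(1)[of "p i"] by (auto simp: I_def)
    qed
    also have "\<dots> = (\<Prod>i\<in>I. 1 / q)"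
      unfolding I_def by (subst prod.inter_filter[symmetric]) (auto intro!: prod.cong)
    also have "\<dots> = (1 / q) ^ k" by (simp add: k_def)
    finally have "norm (\<Prod>i<j. \<sigma> (p i)) * norm (\<Phi> (\<Sum>i<j. p i)) \<le> (1 / q) ^ k * norm (\<Phi> (\<Sum>i<j. p i))"
      by (rule mult_right_mono) simp
    also have "\<dots> < (1 / q) ^ k * q ^ k" using \<Phi>_lt q by (intro mult_strict_left_mono) auto
    also have "\<dots> = 1" using q by (simp add: power_mult_distrib[symmetric])
    finally show ?thesis by (simp add: norm_mult)
  next
    case 3
    have "I = {..<j}" using 3 unfolding k_def I_def by (intro card_subset_eq) auto
    then have pB: "p i \<in> B" if "i < m" for i using that 3 by (auto simp: I_def)
    have "\<exists>i i'. i < m \<and> i' < m \<and> p i \<noteq> p i'"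
    proof (rule ccontr)
      assume eq: "\<not> ?thesis"
      have "p = (\<lambda>i\<in>{..<m}. p 0)"
      proof
        fix i
        show "p i = (\<lambda>i\<in>{..<m}. p 0) i"
        proof (cases "i < m")
          case True
          moreover have "0 < m" using m by simp
          ultimately have "p i = p 0" using eq by blast
          then show ?thesis using True by simp
        next
          case False
          then show ?thesis using PiE_arb[OF p, of i] 3 by simp
        qed
      qed
      moreover have "p 0 \<in> B" using pB m by simp
      ultimately show False using nonconst 3 by blast
    qed
    then obtain i i' where "i < m" "i' < m" "p i \<noteq> p i'" by blast
    from jensen[OF pB this]
    have jen: "norm (\<Phi> (\<Sum>i<m. p i)) ^ m < (\<Prod>i<m. norm (\<Phi> (of_nat m * p i)))" .
    have unit: "norm (\<sigma> s) ^ m * norm (\<Phi> (of_nat m * s)) = 1" if "s \<in> B" for s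
      using arg_cong[OF B(1)[OF that], of norm] by (simp add: norm_mult norm_power)
    have pos: "0 < (\<Prod>i<m. norm (\<sigma> (p i)) ^ m)"
    proof (rule prod_pos)
      fix i assume "i \<in> {..<m}"
      then have "norm (\<sigma> (p i)) ^ m \<noteq> 0" using unit[OF pB[of i]] m by (auto simp: power_0_left)
      then show "0 < norm (\<sigma> (p i)) ^ m" using zero_le_power[OF norm_ge_zero, of "\<sigma> (p i)" m] by linarith
    qed
    have "norm ((\<Prod>i<j. \<sigma> (p i)) * \<Phi> (\<Sum>i<j. p i)) ^ m
        = (\<Prod>i<m. norm (\<sigma> (p i)) ^ m) * norm (\<Phi> (\<Sum>i<m. p i)) ^ m"
      by (simp add: 3 norm_mult power_mult_distrib prod_norm[symmetric] prod_power_distrib)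
    also have "\<dots> < (\<Prod>i<m. norm (\<sigma> (p i)) ^ m) * (\<Prod>i<m. norm (\<Phi> (of_nat m * p i)))"
      using jen pos by (rule mult_strict_left_mono)
    also have "\<dots> = (\<Prod>i<m. norm (\<sigma> (p i)) ^ m * norm (\<Phi> (of_nat m * p i)))"
      by (rule prod.distrib[symmetric])
    also have "\<dots> = 1" using unit pB by simp
    finally have "norm ((\<Prod>i<j. \<sigma> (p i)) * \<Phi> (\<Sum>i<j. p i)) ^ m < 1 ^ m" by simp
    then show ?thesis by (rule power_less_imp_less_base) simp
  qed
qed

text \<open>
  The finitely many strict inequalities are open conditions.
\<close>
lemma separating_neighbourhood:
  assumes cont: "continuous_on UNIV \<Phi>" and q: "q ^ m < norm (\<Phi> w)"
    and below: "\<And>k. k \<in> {1..<m} \<Longrightarrow> norm (\<Phi> (of_nat k * w / of_nat m)) < q ^ k"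
  obtains \<delta> where "0 < \<delta>" "\<And>x. norm x < \<delta> \<Longrightarrow> q ^ m < norm (\<Phi> (w + x))"
    "\<And>k x. k \<in> {1..<m} \<Longrightarrow> norm x < \<delta> \<Longrightarrow> norm (\<Phi> (of_nat k * w / of_nat m + x)) < q ^ k"
proof -
  have c: "continuous_on UNIV (\<lambda>x. norm (\<Phi> (a + x)))" for a
    by (intro continuous_intros continuous_on_compose2[OF cont]) auto
  have "open {x. q ^ m < norm (\<Phi> (w + x))}"
    by (intro open_Collect_less c continuous_intros)
  then have 1: "\<forall>\<^sub>F x in nhds 0. q ^ m < norm (\<Phi> (w + x))"
    using q eventually_nhds_in_open[of "{x. q ^ m < norm (\<Phi> (w + x))}" 0] by simp
  have "\<forall>\<^sub>F x in nhds 0. norm (\<Phi> (of_nat k * w / of_nat m + x)) < q ^ k" if "k \<in> {1..<m}" for k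
  proof -
    have "open {x. norm (\<Phi> (of_nat k * w / of_nat m + x)) < q ^ k}"
      by (intro open_Collect_less c continuous_intros)
    then show ?thesis
      using below[OF that] eventually_nhds_in_open[of "{x. norm (\<Phi> (of_nat k * w / of_nat m + x)) < q ^ k}" 0] by simp
  qed
  then have 2: "\<forall>\<^sub>F x in nhds 0. \<forall>k\<in>{1..<m}. norm (\<Phi> (of_nat k * w / of_nat m + x)) < q ^ k"
    by (intro eventually_ball_finite) auto
  obtain \<delta> where \<delta>: "0 < \<delta>" "\<And>x. dist x 0 < \<delta> \<Longrightarrow> q ^ m < norm (\<Phi> (w + x)) \<and>
      (\<forall>k\<in>{1..<m}. norm (\<Phi> (of_nat k * w / of_nat m + x)) < q ^ k)"
    using eventually_conj[OF 1 2] unfolding eventually_nhds_metric by blast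
  show ?thesis by (rule that[OF \<delta>(1)]) (use \<delta>(2) in auto)
qed

section \<open>Existence of a hypercyclic algebra\<close>

text \<open>
  The frequencies are chosen in this order: a neighbourhood of \<open>w\<close> on which the growth of
  the words is separated, a segment of strict convexity inside it, the set \<open>\<Lambda>\<close> on
  that segment with an exponential sum near \<open>h\<close>, and a set \<open>\<Gamma>\<close> of small
  multiples of \<open>z0\<close> with an exponential sum near \<open>g\<close>. The set
  \<open>B\<close> is \<open>\<Lambda>\<close> divided by \<open>m\<close>.
\<close>
lemma powers_transitive:
  assumes hol: "\<Phi> holomorphic_on UNIV" and op: "entire_operator T"
    and eigen: "\<And>c. T (\<lambda>z. exp (c * z)) = (\<lambda>z. \<Phi> c * exp (c * z))"
    and z0: "z0 \<noteq> 0" "\<And>t. 0 < t \<Longrightarrow> t \<le> 1 \<Longrightarrow> norm (\<Phi> (of_real t * z0)) < 1"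
    and w: "norm (\<Phi> w) > 1"
      "\<And>k m. 1 \<le> k \<Longrightarrow> k < m \<Longrightarrow> norm (\<Phi> (of_nat k * w / of_nat m)) ^ m < norm (\<Phi> w) ^ k"
      "\<And>\<alpha> \<beta>. \<exists>z. \<Phi> z \<noteq> exp (\<alpha> + \<beta> * z)"
    and g: "g \<in> entire_functions" and h: "h \<in> entire_functions" and \<epsilon>: "0 < \<epsilon>" and m: "1 \<le> m"
  shows "\<exists>N. \<exists>f\<in>entire_functions. \<forall>z\<in>cball 0 R. norm (f z - g z) < \<epsilon> \<and>
      (\<forall>j\<in>{1..<m}. norm ((T ^^ N) (\<lambda>z. f z ^ j) z) < \<epsilon>) \<and>
      norm ((T ^^ N) (\<lambda>z. f z ^ m) z - h z) < \<epsilon>"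
proof -
  interpret entire_operator T by fact
  obtain q where q: "1 < q" "q ^ m < norm (\<Phi> w)"
      "\<And>k. k \<in> {1..<m} \<Longrightarrow> norm (\<Phi> (of_nat k * w / of_nat m)) < q ^ k"
    by (rule powers_separated[OF m w(1), of "\<lambda>k. norm (\<Phi> (of_nat k * w / of_nat m))"])
      (use w(2) in auto)
  obtain \<delta> where \<delta>: "0 < \<delta>" and above: "\<And>x. norm x < \<delta> \<Longrightarrow> q ^ m < norm (\<Phi> (w + x))"
    and near: "\<And>k x. k \<in> {1..<m} \<Longrightarrow> norm x < \<delta> \<Longrightarrow> norm (\<Phi> (of_nat k * w / of_nat m + x)) < q ^ k"
    by (rule separating_neighbourhood[OF holomorphic_on_imp_continuous_on[OF hol] q(2,3)], assumption, rule that)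
  have qm: "1 < q ^ m" using q(1) m by (simp add: one_less_power)
  have big: "1 < norm (\<Phi> z)" if "z \<in> ball w (\<delta>/2)" for z
  proof -
    have "norm (z - w) < \<delta>" using that \<delta> by (simp add: dist_norm norm_minus_commute)
    then show ?thesis using above[of "z - w"] qm by simp
  qed
  have "0 < \<delta> / 2" using \<delta> by simp
  have nz: "\<Phi> z \<noteq> 0" if "z \<in> ball w (\<delta>/2)" for z using big[OF that] by auto
  obtain w' d \<eta> where d: "d \<noteq> 0" and \<eta>: "0 < \<eta>"
    and seg: "\<And>t. t \<in> {0..<\<eta>} \<Longrightarrow> w' + of_real t * d \<in> ball w (\<delta>/2)"
    and jensen: "\<forall>m t. (\<forall>i<m. t i \<in> {0..<\<eta>}) \<and> (\<exists>i<m. \<exists>j<m. t i \<noteq> t j) \<longrightarrow>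
       norm (\<Phi> (w' + of_real ((\<Sum>i<m. t i) / real m) * d)) ^ m < (\<Prod>i<m. norm (\<Phi> (w' + of_real (t i) * d)))"
    by (rule log_norm_strictly_convex_direction[OF hol \<open>0 < \<delta> / 2\<close> nz w(3)], assumption, rule that)
  have \<epsilon>2: "0 < \<epsilon> / 2" using \<epsilon> by simp
  obtain \<Lambda> c where \<Lambda>: "finite \<Lambda>" "\<Lambda> \<subseteq> (\<lambda>t. w' + of_real t * d) ` {0..<\<eta>}"
      "\<And>z. z \<in> cball 0 R \<Longrightarrow> norm ((\<Sum>\<nu>\<in>\<Lambda>. c \<nu> * exp (\<nu> * z)) - h z) < \<epsilon> / 2"
    using exponential_sums_dense[OF h \<epsilon>2 d \<eta> order_refl, of w' R] by blast
  define B where "B = (\<lambda>\<nu>. \<nu> / of_nat m) ` \<Lambda>"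
  have mB: "of_nat m * s \<in> \<Lambda>" if "s \<in> B" for s using that m by (auto simp: B_def)
  define \<tau> where "\<tau> = min (1 / real m) (\<delta> / (2 * real m * norm z0))"
  have \<tau>: "0 < \<tau>" using m \<delta> z0 by (simp add: \<tau>_def)
  \<comment> \<open>The bound $1/m$ keeps sums of up to \<open>m\<close> elements on the segment to
    \<open>z0\<close>; the other bound makes them smaller than \<open>\<delta>\<close> in modulus.\<close>
  define S where "S = (\<lambda>t. of_real t * z0) ` {0<..<\<tau>}"
  have sub: "(\<lambda>t. of_real (\<tau>/2) * z0 + of_real t * z0) ` {0..<\<tau>/2} \<subseteq> S"
  proof
    fix x assume "x \<in> (\<lambda>t. of_real (\<tau>/2) * z0 + of_real t * z0) ` {0..<\<tau>/2}"
    then obtain t where "t \<in> {0..<\<tau>/2}" "x = of_real (\<tau>/2 + t) * z0" by (auto simp: ring_distribs)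
    then show "x \<in> S" unfolding S_def by (intro image_eqI[of _ _ "\<tau>/2 + t"]) (use \<tau> in auto)
  qed
  have "0 < \<tau> / 2" using \<tau> by simp
  obtain \<Gamma> a where \<Gamma>: "finite \<Gamma>" "\<Gamma> \<subseteq> S"
      "\<And>z. z \<in> cball 0 R \<Longrightarrow> norm ((\<Sum>s\<in>\<Gamma>. a s * exp (s * z)) - g z) < \<epsilon> / 2"
    using exponential_sums_dense[OF g \<epsilon>2 z0(1) \<open>0 < \<tau> / 2\<close> sub, of R] by blast
  have \<Gamma>_S: "\<exists>t. 0 < t \<and> t < \<tau> \<and> s = of_real t * z0" if "s \<in> \<Gamma>" for s
  proof -
    have "s \<in> S" using that \<Gamma>(2) by blast
    then show ?thesis unfolding S_def by auto
  qed
  have \<Gamma>_seg: "\<exists>t. 0 < t \<and> t \<le> 1 / real m \<and> s = of_real t * z0" if s: "s \<in> \<Gamma>" for s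
  proof -
    obtain t where "0 < t" "t < \<tau>" "s = of_real t * z0" using \<Gamma>_S[OF s] by blast
    then show ?thesis by (intro exI[of _ t]) (auto simp: \<tau>_def)
  qed
  have \<Gamma>_norm: "norm s < \<delta> / (2 * real m)" if s: "s \<in> \<Gamma>" for s
  proof -
    obtain t where "0 < t" "t < \<tau>" "s = of_real t * z0" using \<Gamma>_S[OF s] by blast
    moreover from this have "t < \<delta> / (2 * real m * norm z0)" by (simp add: \<tau>_def)
    ultimately show ?thesis using z0 m by (simp add: norm_mult field_simps)
  qed
  have \<Lambda>_ball: "\<nu> \<in> ball w (\<delta>/2)" if "\<nu> \<in> \<Lambda>" for \<nu> using that \<Lambda>(2) seg by auto
  \<comment> \<open>The modulus of \<open>\<Phi>\<close> is less than 1 at \<open>m\<close> times an element of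
    \<open>\<Gamma>\<close> and greater than 1 at \<open>m\<close> times an element of
    \<open>B\<close>.\<close>
  have disj: "\<Gamma> \<inter> B = {}"
  proof (rule ccontr)
    assume "\<Gamma> \<inter> B \<noteq> {}"
    then obtain s where s: "s \<in> \<Gamma>" "s \<in> B" by blast
    obtain t where t: "0 < t" "t \<le> 1 / real m" "s = of_real t * z0" using \<Gamma>_seg[OF s(1)] by blast
    have "norm (\<Phi> (of_real (real m * t) * z0)) < 1" using t m by (intro z0(2)) (auto simp: field_simps)
    moreover have "1 < norm (\<Phi> (of_nat m * s))" by (rule big[OF \<Lambda>_ball[OF mB[OF s(2)]]])
    ultimately show False by (simp add: t(3) mult.assoc)
  qed
  have "\<forall>c::complex. \<exists>x. x ^ m = c" using exists_complex_root[of m] m by (metis not_one_le_zero)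
  from choice[OF this] obtain rt where rt: "\<And>c::complex. rt c ^ m = c" by blast
  define \<sigma> where "\<sigma> s = (if s \<in> \<Gamma> then 1 else rt (1 / \<Phi> (of_nat m * s)))" for s
  define \<rho> where "\<rho> s = (if s \<in> \<Gamma> then a s else rt (c (of_nat m * s)))" for s
  have \<sigma>\<Gamma>: "\<sigma> s = 1" if "s \<in> \<Gamma>" for s using that by (simp add: \<sigma>_def)
  have \<sigma>B: "\<sigma> s ^ m * \<Phi> (of_nat m * s) = 1" if "s \<in> B" for s
  proof -
    have "s \<notin> \<Gamma>" "\<Phi> (of_nat m * s) \<noteq> 0" using that disj big[OF \<Lambda>_ball[OF mB[OF that]]] by auto
    then show ?thesis by (simp add: \<sigma>_def rt)
  qed
  have \<sigma>B_less: "norm (\<sigma> s) < 1" if "s \<in> B" for s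
  proof -
    have eq: "norm (\<sigma> s) ^ m * norm (\<Phi> (of_nat m * s)) = 1"
      using arg_cong[OF \<sigma>B[OF that], of norm] by (simp add: norm_mult norm_power)
    have gt: "1 < norm (\<Phi> (of_nat m * s))" by (rule big[OF \<Lambda>_ball[OF mB[OF that]]])
    show ?thesis
    proof (rule ccontr)
      assume "\<not> norm (\<sigma> s) < 1"
      then have "1 * norm (\<Phi> (of_nat m * s)) \<le> norm (\<sigma> s) ^ m * norm (\<Phi> (of_nat m * s))"
        by (intro mult_right_mono) (simp_all add: one_le_power)
      then show False using eq gt by simp
    qed
  qed
  have \<rho>B: "\<rho> s ^ m = c (of_nat m * s)" if "s \<in> B" for s
    using that disj by (auto simp: \<rho>_def rt)
  have B_near: "norm (s - w / of_nat m) < \<delta> / (2 * real m)" if "s \<in> B" for s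
  proof -
    have "s - w / of_nat m = (of_nat m * s - w) / of_nat m" using m by (simp add: field_simps)
    moreover have "norm (of_nat m * s - w) < \<delta> / 2"
      using \<Lambda>_ball[OF mB[OF that]] by (simp add: dist_norm norm_minus_commute)
    ultimately show ?thesis using m by (simp add: norm_divide field_simps)
  qed
  have B_jensen: "norm (\<Phi> (\<Sum>i<m. p i)) ^ m < (\<Prod>i<m. norm (\<Phi> (of_nat m * p i)))"
    if p: "\<And>i. i < m \<Longrightarrow> p i \<in> B" and ij: "i < m" "j < m" "p i \<noteq> p j" for p i j
  proof -
    have "\<forall>i\<in>{..<m}. \<exists>t. t \<in> {0..<\<eta>} \<and> of_nat m * p i = w' + of_real t * d"
      using mB[OF p] \<Lambda>(2) by blast
    from bchoice[OF this] obtain t where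
      t: "\<And>i. i < m \<Longrightarrow> t i \<in> {0..<\<eta>}" "\<And>i. i < m \<Longrightarrow> of_nat m * p i = w' + of_real (t i) * d" by auto
    have "t i \<noteq> t j"
    proof
      assume "t i = t j"
      then have "of_nat m * p i = of_nat m * p j" using t(2)[OF ij(1)] t(2)[OF ij(2)] by simp
      then show False using ij m by simp
    qed
    then have "norm (\<Phi> (w' + of_real ((\<Sum>i<m. t i) / real m) * d)) ^ m
        < (\<Prod>i<m. norm (\<Phi> (w' + of_real (t i) * d)))"
      using jensen t(1) ij(1,2) by blast
    moreover have "(\<Sum>i<m. p i) = w' + of_real ((\<Sum>i<m. t i) / real m) * d"
    proof -
      have "of_nat m * (\<Sum>i<m. p i) = (\<Sum>i<m. w' + of_real (t i) * d)"
        unfolding sum_distrib_left using t(2) by simp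
      also have "\<dots> = of_nat m * w' + of_real (\<Sum>i<m. t i) * d"
        by (simp add: sum.distrib sum_distrib_right)
      finally show ?thesis using m by (simp add: field_simps)
    qed
    ultimately show ?thesis using t(2) by simp
  qed
  have words: "norm ((\<Prod>i<j. \<sigma> (p i)) * \<Phi> (\<Sum>i<j. p i)) < 1"
    if "1 \<le> j" "j \<le> m" "p \<in> {..<j} \<rightarrow>\<^sub>E (\<Gamma> \<union> B)" "\<not> (j = m \<and> (\<exists>s\<in>B. p = (\<lambda>i\<in>{..<m}. s)))" for j p
    by (rule mixed_words_contract[OF m q(1) \<delta> \<sigma>\<Gamma> \<Gamma>_norm \<Gamma>_seg z0(2) \<sigma>B B_near near above B_jensen that])
  have finB: "finite B" using \<Lambda>(1) by (simp add: B_def)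
  have "\<exists>N. \<exists>f\<in>entire_functions. \<forall>z\<in>cball 0 R.
      norm (f z - (\<Sum>s\<in>\<Gamma>. \<rho> s * exp (s * z))) < \<epsilon> / 2 \<and>
      (\<forall>j\<in>{1..<m}. norm ((T ^^ N) (\<lambda>z. f z ^ j) z) < \<epsilon> / 2) \<and>
      norm ((T ^^ N) (\<lambda>z. f z ^ m) z - (\<Sum>s\<in>B. c (of_nat m * s) * exp (of_nat m * s * z))) < \<epsilon> / 2"
    by (rule constant_words_dominate[OF eigen \<Gamma>(1) finB disj m \<sigma>\<Gamma> \<sigma>B_less \<sigma>B \<rho>B words \<epsilon>2])
  then obtain N f where f: "f \<in> entire_functions" and N: "\<And>z. z \<in> cball 0 R \<Longrightarrow>
      norm (f z - (\<Sum>s\<in>\<Gamma>. \<rho> s * exp (s * z))) < \<epsilon> / 2 \<and>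
      (\<forall>j\<in>{1..<m}. norm ((T ^^ N) (\<lambda>z. f z ^ j) z) < \<epsilon> / 2) \<and>
      norm ((T ^^ N) (\<lambda>z. f z ^ m) z - (\<Sum>s\<in>B. c (of_nat m * s) * exp (of_nat m * s * z))) < \<epsilon> / 2"
    by blast
  have "norm (f z - g z) < \<epsilon> \<and> (\<forall>j\<in>{1..<m}. norm ((T ^^ N) (\<lambda>z. f z ^ j) z) < \<epsilon>) \<and>
      norm ((T ^^ N) (\<lambda>z. f z ^ m) z - h z) < \<epsilon>" if z: "z \<in> cball 0 R" for z
  proof -
    have "(\<Sum>s\<in>\<Gamma>. \<rho> s * exp (s * z)) = (\<Sum>s\<in>\<Gamma>. a s * exp (s * z))" by (simp add: \<rho>_def)
    then have 1: "norm (f z - g z) < \<epsilon>"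
      using N[OF z] \<Gamma>(3)[OF z] norm_triangle_ineq[of "f z - (\<Sum>s\<in>\<Gamma>. a s * exp (s * z))"
          "(\<Sum>s\<in>\<Gamma>. a s * exp (s * z)) - g z"] by simp
    have "inj_on (\<lambda>\<nu>. \<nu> / of_nat m) \<Lambda>" using m by (auto simp: inj_on_def)
    then have "(\<Sum>s\<in>B. c (of_nat m * s) * exp (of_nat m * s * z)) = (\<Sum>\<nu>\<in>\<Lambda>. c \<nu> * exp (\<nu> * z))"
      unfolding B_def using m by (simp add: sum.reindex)
    then have 2: "norm ((T ^^ N) (\<lambda>z. f z ^ m) z - h z) < \<epsilon>"
      using N[OF z] \<Lambda>(3)[OF z] norm_triangle_ineq[of "(T ^^ N) (\<lambda>z. f z ^ m) z - (\<Sum>\<nu>\<in>\<Lambda>. c \<nu> * exp (\<nu> * z))"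
          "(\<Sum>\<nu>\<in>\<Lambda>. c \<nu> * exp (\<nu> * z)) - h z"] by simp
    have "norm ((T ^^ N) (\<lambda>z. f z ^ j) z) < \<epsilon>" if "j \<in> {1..<m}" for j
      using N[OF z] that \<epsilon> by fastforce
    then show ?thesis using 1 2 by blast
  qed
  then show ?thesis using f by blast
qed

theorem theorem1p6:
  fixes \<Phi> :: "complex \<Rightarrow> complex" and z0 z1 :: complex
  assumes "\<Phi> holomorphic_on UNIV"
    and "exponential_type \<Phi>"
    and "z0 \<in> open_segment 0 z1"
    and "\<forall>z \<in> closed_segment 0 z0 - {0}. norm (\<Phi> z) < 1"
    and "ereal (norm (\<Phi> z1)) > max 1 (exp_ereal (radial_growth \<Phi> z1 * ereal (norm z1)))"
  shows "supports_hypercyclic_algebra (diff_operator \<Phi>)"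
proof -
  interpret entire_operator "diff_operator \<Phi>"
    by (rule entire_operator_diff_operator[OF assms(1,2)])
  obtain w where w: "norm (\<Phi> w) > 1"
    "\<And>k m. 1 \<le> k \<Longrightarrow> k < m \<Longrightarrow> norm (\<Phi> (of_nat k * w / of_nat m)) ^ m < norm (\<Phi> w) ^ k"
    "\<And>\<alpha> \<beta>. \<exists>z. \<Phi> z \<noteq> exp (\<alpha> + \<beta> * z)"
    by (rule subordinate_growth[OF assms(1,3,4,5)], rule that)
  have z0: "z0 \<noteq> 0" using assms(3) by (auto simp: open_segment_def)
  have "norm (\<Phi> (of_real t * z0)) < 1" if "0 < t" "t \<le> 1" for t
  proof -
    have "of_real t * z0 \<in> closed_segment 0 z0"
      using that by (auto simp: in_segment scaleR_conv_of_real intro!: exI[of _ t])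
    then show ?thesis using assms(4) that z0 by simp
  qed
  then show ?thesis
    by (intro supports_hypercyclic_algebra_if_powers_transitive
        powers_transitive[OF assms(1) entire_operator_axioms diff_operator_exp[OF assms(1)] z0 _ w])
qed

end
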